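(* Let $n\ge2$. If $\dim E=n-1\equiv 1,2,3,5 \pmod 8$, then every spin representation $\rho:\mathfrak{heis}_b\to\mathfrak{gl}_{\mathbb R}(S)$ of the Heisenberg algebra $\mathfrak{heis}_b=E^*+E+\mathbb R\mathrm p$ has zero charge, i.e. $\rho(\mathrm p)=0$.
   Context: $E=\mathbb R^{0,n-1}$ is an $(n-1)$-dimensional real vector space with a negative definite inner product $\langle\cdot,\cdot\rangle$; $e^\flat=\langle e,\cdot\rangle\in E^*$. $b$ is a non-degenerate symmetric bilinear form on $E$ and $B\in\mathrm{End}_{\mathbb R}(E)$ is defined by $b(\cdot,\cdot)=-\langle B\cdot,\cdot\rangle$. The Heisenberg algebra $\mathfrak{heis}_b=E^*+E+\mathbb R\mathrm p$ has as only non-trivial brackets $[e^\flat,f]=b(e,f)\mathrm p$ ($e,f\in E$). $\mathrm{Cl}_{0,n-1}$ is the Clifford algebra of $E$ with convention $v^2=-\langle v,v\rangle$ (so unit vectors of $E$ square to $+1$), $S_{0,n-1}$ is a real irreducible $\mathrm{Cl}_{0,n-1}$-module, on which vectors of $E$ act by Clifford multiplication. Let $\mathfrak m=E+\mathbb R\mathrm p+\mathbb R\mathrm q$ be Minkowski space ($\mathrm p,\mathrm q$ isotropic, orthogonal to $E$, $\langle\mathrm p,\mathrm q\rangle=1$) and $S=S_{1,n}$ the real irreducible $\mathrm{Cl}(\mathfrak m)$-module. It is identified, as a vector space, with $S=S_-+S_+=S_{0,n-1}+S_{0,n-1}$ (endomorphisms written as $2\times2$ block matrices) in such a way that $\mathrm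 p\wedge e\in\mathfrak{so}(\mathfrak m)$ acts as $\begin{pmatrix}0&\sqrt2\,e\\0&0\end{pmatrix}$. A Lie algebra representation $\rho:\mathfrak{heis}_b\to\mathfrak{gl}_{\mathbb R}(S)$ is called spin if $\rho(e^\flat)$ is the spin action of $\mathrm p\wedge Be$, i.e. $\rho(e^\flat)=\begin{pmatrix}0&\sqrt2\,Be\\0&0\end{pmatrix}$ for all $e\in E$. *)

theory Defs
  imports
    "HOL-Analysis.Analysis"
    "HOL-Library.Poly_Mapping"
    "HOL-Algebra.QuotRing"
begin

section \<open>The Clifford algebra of a real vector space with a bilinear form\<close>

text \<open>Lists form a monoid under concatenation, so the finitely supported functions
  \<^typ>\<open>'v list \<Rightarrow>\<^sub>0 real\<close> with the convolution product are the free associative real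
  algebra on the set \<^typ>\<open>'v\<close>.\<close>

instantiation list :: (type) monoid_add
begin

definition zero_list :: "'a list" where "zero_list = []"

definition plus_list :: "'a list \<Rightarrow> 'a list \<Rightarrow> 'a list" where "plus_list xs ys = xs @ ys"

instance
  by standard (simp_all add: zero_list_def plus_list_def)

end

definition free_algebra :: "('v list \<Rightarrow>\<^sub>0 real) ring" where
  "free_algebra = \<lparr>carrier = UNIV, mult = (*), one = 1, zero = 0, add = (+)\<rparr>"

definition free_gen :: "'v \<Rightarrow> ('v list \<Rightarrow>\<^sub>0 real)" where
  "free_gen v = Poly_Mapping.single [v] 1"

definition free_const :: "real \<Rightarrow> ('v list \<Rightarrow>\<^sub>0 real)" where
  "free_const r = Poly_Mapping.single [] r"

text \<open>The first two families of relations make the generators linear (the quotient by them is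
  the tensor algebra); the last one is \<open>v\<^sup>2 = - \<langle>v, v\<rangle>\<close>.\<close>

definition clifford_relations ::
    "('v::real_vector \<Rightarrow> 'v \<Rightarrow> real) \<Rightarrow> ('v list \<Rightarrow>\<^sub>0 real) set" where
  "clifford_relations g =
     {free_gen (u + v) - (free_gen u + free_gen v) | u v. True} \<union>
     {free_gen (r *\<^sub>R v) - free_const r * free_gen v | r v. True} \<union>
     {free_gen v * free_gen v + free_const (g v v) | v. True}"

definition clifford_ideal ::
    "('v::real_vector \<Rightarrow> 'v \<Rightarrow> real) \<Rightarrow> ('v list \<Rightarrow>\<^sub>0 real) set" where
  "clifford_ideal g = Idl\<^bsub>free_algebra\<^esub> (clifford_relations g)"

definition clifford_algebra ::
    "('v::real_vector \<Rightarrow> 'v \<Rightarrow> real) \<Rightarrow> ('v list \<Rightarrow>\<^sub>0 real) set ring" where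
  "clifford_algebra g = free_algebra Quot clifford_ideal g"

definition clifford_vec ::
    "('v::real_vector \<Rightarrow> 'v \<Rightarrow> real) \<Rightarrow> 'v \<Rightarrow> ('v list \<Rightarrow>\<^sub>0 real) set" where
  "clifford_vec g v = clifford_ideal g +>\<^bsub>free_algebra\<^esub> free_gen v"

definition clifford_scalar ::
    "('v::real_vector \<Rightarrow> 'v \<Rightarrow> real) \<Rightarrow> real \<Rightarrow> ('v list \<Rightarrow>\<^sub>0 real) set" where
  "clifford_scalar g r = clifford_ideal g +>\<^bsub>free_algebra\<^esub> free_const r"

lemma ring_free_algebra: "ring (free_algebra :: ('v list \<Rightarrow>\<^sub>0 real) ring)"
proof (rule ringI)
  show "abelian_group (free_algebra :: ('v list \<Rightarrow>\<^sub>0 real) ring)"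
  proof (rule abelian_groupI)
    fix x :: "'v list \<Rightarrow>\<^sub>0 real"
    have "- x + x = 0" by simp
    then show "\<exists>y\<in>carrier free_algebra. y \<oplus>\<^bsub>free_algebra\<^esub> x = \<zero>\<^bsub>free_algebra\<^esub>"
      unfolding free_algebra_def by (auto intro!: exI[of _ "- x"])
  qed (simp_all add: free_algebra_def ac_simps)
  show "Group.monoid (free_algebra :: ('v list \<Rightarrow>\<^sub>0 real) ring)"
    by (rule Group.monoidI) (simp_all add: free_algebra_def mult.assoc)
qed (simp_all add: free_algebra_def distrib_left distrib_right)

lemma ideal_clifford_ideal: "ideal (clifford_ideal g) free_algebra"
  unfolding clifford_ideal_def
  by (rule ring.genideal_ideal[OF ring_free_algebra]) (simp add: free_algebra_def)

lemma ring_clifford_algebra: "ring (clifford_algebra g)"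
  unfolding clifford_algebra_def by (rule ideal.quotient_is_ring[OF ideal_clifford_ideal])

lemma clifford_coset_add_eq:
  assumes "x + y \<in> clifford_ideal g"
  shows "clifford_ideal g +>\<^bsub>free_algebra\<^esub> x = clifford_ideal g +>\<^bsub>free_algebra\<^esub> (- y)"
proof -
  interpret ideal "clifford_ideal g" free_algebra by (rule ideal_clifford_ideal)
  have "x \<in> clifford_ideal g +>\<^bsub>free_algebra\<^esub> (- y)"
    unfolding a_r_coset_def' using assms by (auto simp: free_algebra_def intro!: bexI[of _ "x + y"])
  from a_repr_independence[OF this _ a_subgroup] show ?thesis
    by (simp add: free_algebra_def)
qed

lemma clifford_vec_square:
  "clifford_vec g v \<otimes>\<^bsub>clifford_algebra g\<^esub> clifford_vec g v = clifford_scalar g (- g v v)"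
proof -
  interpret ideal "clifford_ideal g" free_algebra by (rule ideal_clifford_ideal)
  have "free_gen v * free_gen v + free_const (g v v) \<in> clifford_relations g"
    unfolding clifford_relations_def by blast
  then have "free_gen v * free_gen v + free_const (g v v) \<in> clifford_ideal g"
    unfolding clifford_ideal_def
    using ring.genideal_self[OF ring_free_algebra, of "clifford_relations g"]
    by (auto simp: free_algebra_def)
  note coset = clifford_coset_add_eq[OF this]
  have mult: "clifford_vec g v \<otimes>\<^bsub>clifford_algebra g\<^esub> clifford_vec g v =
      clifford_ideal g +>\<^bsub>free_algebra\<^esub> (free_gen v * free_gen v)"
    using rcoset_mult_add[of "free_gen v" "free_gen v"]
    unfolding clifford_algebra_def FactRing_def clifford_vec_def by (simp add: free_algebra_def)
  show ?thesis
    unfolding mult coset clifford_scalar_def by (simp only: free_const_def single_uminus)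
qed

text \<open>The spin image \<open>(u v - v u) / 4\<close> of \<open>u \<and> v\<close>, regarded as the skew endomorphism
  \<open>w \<mapsto> \<langle>u, w\<rangle> v - \<langle>v, w\<rangle> u\<close>: this is the commutator with \<open>w\<close> in the Clifford algebra.\<close>

definition spin_wedge ::
    "('v::real_vector \<Rightarrow> 'v \<Rightarrow> real) \<Rightarrow> 'v \<Rightarrow> 'v \<Rightarrow> ('v list \<Rightarrow>\<^sub>0 real) set" where
  "spin_wedge g u v =
     clifford_scalar g (1 / 4) \<otimes>\<^bsub>clifford_algebra g\<^esub>
       (clifford_vec g u \<otimes>\<^bsub>clifford_algebra g\<^esub> clifford_vec g v
        \<ominus>\<^bsub>clifford_algebra g\<^esub> clifford_vec g v \<otimes>\<^bsub>clifford_algebra g\<^esub> clifford_vec g u)"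


section \<open>Real Clifford modules\<close>

definition endo_ring :: "('s::real_vector \<Rightarrow> 's) ring" where
  "endo_ring = \<lparr>carrier = {f. linear f}, mult = (\<circ>), one = id,
     zero = (\<lambda>_. 0), add = (\<lambda>f h x. f x + h x)\<rparr>"

definition clifford_module ::
    "('v::real_vector \<Rightarrow> 'v \<Rightarrow> real) \<Rightarrow> (('v list \<Rightarrow>\<^sub>0 real) set \<Rightarrow> 's::real_vector \<Rightarrow> 's) \<Rightarrow> bool"
  where
  "clifford_module g \<gamma> \<longleftrightarrow>
     \<gamma> \<in> ring_hom (clifford_algebra g) endo_ring \<and>
     (\<forall>r s. \<gamma> (clifford_scalar g r) s = r *\<^sub>R s)"

definition irreducible_clifford_module ::
    "('v::real_vector \<Rightarrow> 'v \<Rightarrow> real) \<Rightarrow> (('v list \<Rightarrow>\<^sub>0 real) set \<Rightarrow> 's::real_vector \<Rightarrow> 's) \<Rightarrow> bool"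
  where
  "irreducible_clifford_module g \<gamma> \<longleftrightarrow>
     clifford_module g \<gamma> \<and>
     (\<exists>s::'s. s \<noteq> 0) \<and>
     (\<forall>W. subspace W \<and> (\<forall>x\<in>carrier (clifford_algebra g). \<gamma> x ` W \<subseteq> W) \<longrightarrow>
          W = {0} \<or> W = UNIV)"


section \<open>The negative definite space \<open>E\<close> and Minkowski space \<open>E + \<real>p + \<real>q\<close>\<close>

text \<open>The negative definite space is a Euclidean space \<^typ>\<open>'e::euclidean_space\<close> with the
  opposite of its inner product.\<close>

definition neg_form :: "'e::euclidean_space \<Rightarrow> 'e \<Rightarrow> real" where
  "neg_form x y = - (x \<bullet> y)"

text \<open>The triple \<open>(x, s, t)\<close> stands for \<open>x + s p + t q\<close>.\<close>

type_synonym 'e minkowski = "'e \<times> real \<times> real"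

definition mink_form :: "'e::euclidean_space minkowski \<Rightarrow> 'e minkowski \<Rightarrow> real" where
  "mink_form = (\<lambda>(x, s, t) (x', s', t'). neg_form x x' + s * t' + t * s')"

definition mink_p :: "'e::euclidean_space minkowski" where
  "mink_p = (0, 1, 0)"

definition mink_E :: "'e::euclidean_space \<Rightarrow> 'e minkowski" where
  "mink_E e = (e, 0, 0)"


section \<open>The Heisenberg algebra\<close>

text \<open>In finite dimension \<^typ>\<open>'e \<Rightarrow>\<^sub>L real\<close> is the full dual space.
  The triple \<open>(\<alpha>, e, t)\<close> stands for \<open>\<alpha> + e + t p\<close> in \<open>E\<^sup>* + E + \<real>p\<close>.\<close>

type_synonym 'e heis = "('e \<Rightarrow>\<^sub>L real) \<times> 'e \<times> real"

definition flat :: "'e::euclidean_space \<Rightarrow> ('e \<Rightarrow>\<^sub>L real)" where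
  "flat e = Blinfun (neg_form e)"

lemma flat_apply: "blinfun_apply (flat e) x = neg_form e x"
proof -
  have "bounded_linear (neg_form e)"
    unfolding neg_form_def by (intro bounded_linear_minus bounded_linear_inner_right)
  then show ?thesis
    by (simp add: flat_def bounded_linear_Blinfun_apply)
qed

lemma bij_flat: "bij (flat :: 'e::euclidean_space \<Rightarrow> ('e \<Rightarrow>\<^sub>L real))"
proof (rule bijI)
  show "inj (flat :: 'e \<Rightarrow> ('e \<Rightarrow>\<^sub>L real))"
  proof (rule injI)
    fix x y :: 'e
    assume "flat x = flat y"
    then have "neg_form x z = neg_form y z" for z by (metis flat_apply)
    then have "\<forall>z. x \<bullet> z = y \<bullet> z" by (simp add: neg_form_def)
    then show "x = y" by (simp only: vector_eq_rdot)
  qed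
  show "surj (flat :: 'e \<Rightarrow> ('e \<Rightarrow>\<^sub>L real))"
  proof (rule surjI)
    fix \<alpha> :: "'e \<Rightarrow>\<^sub>L real"
    have lin: "linear (blinfun_apply \<alpha>)"
      by (rule bounded_linear.linear[OF blinfun.bounded_linear_right])
    show "flat (- adjoint (blinfun_apply \<alpha>) 1) = \<alpha>"
    proof (rule blinfun_eqI)
      fix x
      have "x \<bullet> adjoint (blinfun_apply \<alpha>) 1 = blinfun_apply \<alpha> x"
        using adjoint_works[OF lin, of x 1] by simp
      then show "blinfun_apply (flat (- adjoint (blinfun_apply \<alpha>) 1)) x = blinfun_apply \<alpha> x"
        by (simp only: flat_apply neg_form_def inner_minus_left inner_minus_right minus_minus
            inner_commute[of _ x])
    qed
  qed
qed

definition heis_bracket ::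
    "('e::euclidean_space \<Rightarrow> 'e \<Rightarrow> real) \<Rightarrow> 'e heis \<Rightarrow> 'e heis \<Rightarrow> 'e heis" where
  "heis_bracket b = (\<lambda>(\<alpha>, e, s) (\<beta>, f, t). (0, 0, b (the_inv flat \<alpha>) f - b (the_inv flat \<beta>) e))"

definition heis_p :: "'e::euclidean_space heis" where
  "heis_p = (0, 0, 1)"

definition heis_dual :: "('e::euclidean_space \<Rightarrow>\<^sub>L real) \<Rightarrow> 'e heis" where
  "heis_dual \<alpha> = (\<alpha>, 0, 0)"

definition heis_E :: "'e::euclidean_space \<Rightarrow> 'e heis" where
  "heis_E e = (0, e, 0)"

lemma heis_bracket_flat:
  assumes "bilinear b"
  shows "heis_bracket b (heis_dual (flat e)) (heis_E f) = b e f *\<^sub>R heis_p"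
proof -
  have "flat (0 :: 'a) = 0"
    by (rule blinfun_eqI) (simp add: flat_apply neg_form_def)
  then have "the_inv flat (0 :: 'a \<Rightarrow>\<^sub>L real) = 0"
    using the_inv_f_f[OF bij_is_inj[OF bij_flat], of "0 :: 'a"] by simp
  moreover have "the_inv flat (flat e) = e"
    by (rule the_inv_f_f[OF bij_is_inj[OF bij_flat]])
  moreover have "b 0 0 = 0"
    using assms by (rule bilinear_lzero)
  ultimately show ?thesis
    by (simp add: heis_bracket_def heis_dual_def heis_E_def heis_p_def)
qed


section \<open>Representations\<close>

definition lie_representation ::
    "('g::real_vector \<Rightarrow> 'g \<Rightarrow> 'g) \<Rightarrow> ('g \<Rightarrow> 's::real_vector \<Rightarrow> 's) \<Rightarrow> bool" where
  "lie_representation br \<rho> \<longleftrightarrow>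
     (\<forall>x. linear (\<rho> x)) \<and>
     (\<forall>s. linear (\<lambda>x. \<rho> x s)) \<and>
     (\<forall>x y s. \<rho> (br x y) s = \<rho> x (\<rho> y s) - \<rho> y (\<rho> x s))"

definition block_endo ::
    "('s::real_vector \<Rightarrow> 's) \<Rightarrow> ('s \<Rightarrow> 's) \<Rightarrow> ('s \<Rightarrow> 's) \<Rightarrow> ('s \<Rightarrow> 's) \<Rightarrow> 's \<times> 's \<Rightarrow> 's \<times> 's"
  where
  "block_endo A C D F = (\<lambda>(x, y). (A x + C y, D x + F y))"

text \<open>\<open>\<gamma>\<^sub>0\<close> is the Clifford action of \<open>E\<close> on the common model of \<open>S\<^sub>-\<close> and \<open>S\<^sub>+\<close>; \<open>\<gamma>\<close> is the action of the
  Clifford algebra of Minkowski space on \<open>S = S\<^sub>- + S\<^sub>+\<close>.\<close>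

definition adapted_splitting ::
    "(('e::euclidean_space list \<Rightarrow>\<^sub>0 real) set \<Rightarrow> 's::real_vector \<Rightarrow> 's) \<Rightarrow>
     (('e minkowski list \<Rightarrow>\<^sub>0 real) set \<Rightarrow> 's \<times> 's \<Rightarrow> 's \<times> 's) \<Rightarrow> bool" where
  "adapted_splitting \<gamma>\<^sub>0 \<gamma> \<longleftrightarrow>
     (\<forall>e. \<gamma> (spin_wedge mink_form mink_p (mink_E e)) =
          block_endo (\<lambda>_. 0) (\<lambda>s. sqrt 2 *\<^sub>R \<gamma>\<^sub>0 (clifford_vec neg_form e) s) (\<lambda>_. 0) (\<lambda>_. 0))"

definition spin_representation ::
    "(('e::euclidean_space minkowski list \<Rightarrow>\<^sub>0 real) set \<Rightarrow> 't::real_vector \<Rightarrow> 't) \<Rightarrow>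
     ('e \<Rightarrow> 'e \<Rightarrow> real) \<Rightarrow> ('e \<Rightarrow> 'e) \<Rightarrow> ('e heis \<Rightarrow> 't \<Rightarrow> 't) \<Rightarrow> bool" where
  "spin_representation \<gamma> b B \<rho> \<longleftrightarrow>
     lie_representation (heis_bracket b) \<rho> \<and>
     (\<forall>e. \<rho> (heis_dual (flat e)) = \<gamma> (spin_wedge mink_form mink_p (mink_E (B e))))"

end

theory Submission
  imports Defs
begin

text \<open>
  Write \<open>c v\<close> for Clifford multiplication by \<open>v \<in> E\<close>, let \<open>e\<^sub>0, e\<^sub>1, \<dots>\<close> be the Clifford
  multiplications by an orthonormal basis of the Euclidean space underlying \<open>E\<close>, and put \<open>N = dim E\<close>.
  They are anticommuting linear involutions of \<open>S\<^sub>0\<close>, and \<open>S\<^sub>0\<close> has no proper nonzero subspace that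
  is invariant under all of them (\<open>irreducible_clifford_module_basis\<close>).

  Since \<open>b\<close> is non-degenerate, \<open>B\<close> is onto, so the Heisenberg relation becomes
  \<open>[N\<^sub>u, \<rho>(f)] = (u \<bullet> f) \<rho>(p)\<close>, where \<open>N\<^sub>u\<close> has the single upper right block \<open>\<surd>2 c u\<close> and \<open>u\<close> is
  arbitrary. Take \<open>f\<close> to be the first basis vector. Comparing blocks, and using that \<open>\<rho>(p)\<close> is
  central, shows that \<open>\<rho>(p)\<close> also has a single upper right block, say \<open>\<surd>2 T\<close>, and
  that the diagonal blocks \<open>a\<close> and \<open>h\<close> of \<open>\<rho>(f)\<close> satisfy \<open>e\<^sub>i h - a e\<^sub>i = \<delta>\<^sub>i\<^sub>0 T\<close> and \<open>T h = a T\<close>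
  (\<open>block_charge_vanishes\<close>).

  For \<open>N \<ge> 2\<close> these identities imply that all conjugates \<open>e\<^sub>i T e\<^sub>i\<close> are the same operator \<open>T'\<close>, and that
  \<open>T T' = T' T = 0\<close> (\<open>intertwining_vanishes\<close>). So \<open>P = T + T'\<close> commutes with every \<open>e\<^sub>i\<close>,
  \<open>M = T - T'\<close> anticommutes with every \<open>e\<^sub>i\<close>, and \<open>P\<close> and \<open>M\<close> commute and have the same square.
  By Schur's argument either \<open>P = M = 0\<close>, that is \<open>T = 0\<close>, or \<open>J = P\<^sup>-\<^sup>1 M\<close> is an involution
  of \<open>S\<^sub>0\<close> anticommuting with all \<open>e\<^sub>i\<close>
  (\<open>equal_squares_zero_or_involution\<close>). In other words, a nonzero charge makes the irreducible
  \<open>S\<^sub>0\<close> a module over the Clifford algebra with one more generator. (For \<open>N = 1\<close> the space \<open>S\<^sub>0\<close> is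
  a line, and a direct computation gives \<open>T = 0\<close>.)

  The arithmetic condition on \<open>N\<close> excludes this: the irreducible modules of \<open>N\<close> and \<open>N + 1\<close> anticommuting
  involutions have different dimensions if \<open>N \<equiv> 2, 3 (mod 8)\<close>, and if \<open>N \<equiv> 1, 5 (mod 8)\<close> the product of
  the \<open>e\<^sub>i\<close> is central with square \<open>1\<close>, hence a scalar, and cannot anticommute with \<open>J\<close>.
  The proof in \<open>no_extra_involution\<close> replaces both facts by an elementary form of Bott periodicity:
  the common eigenspace of four commuting involutions built from eight generators is irreducible
  under the remaining \<open>N - 8\<close> generators and still preserved by \<open>J\<close> (\<open>eight_periodicity\<close>). This leaves
  \<open>N = 1, 2, 3, 5\<close>, where \<open>J\<close> would act on an irreducible space of real dimension at most two
  with too many relations, or would anticommute with a scalar.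
\<close>

section \<open>Irreducible families of operators\<close>

text \<open>Irreducibility is relative to a subspace \<open>U\<close>: the reductions below pass to eigenspaces while the
  operators stay globally defined, so that identities between operators need not be restricted.\<close>

definition irreducible_under :: "('s::real_vector \<Rightarrow> 's) set \<Rightarrow> 's set \<Rightarrow> bool" where
  "irreducible_under G U \<longleftrightarrow>
     subspace U \<and> U \<noteq> {0} \<and> (\<forall>g\<in>G. linear g \<and> g ` U \<subseteq> U) \<and>
     (\<forall>W. subspace W \<and> W \<subseteq> U \<and> (\<forall>g\<in>G. g ` W \<subseteq> W) \<longrightarrow> W = {0} \<or> W = U)"

lemma irreducible_underD:
  assumes "irreducible_under G U"
  shows "subspace U" "U \<noteq> {0}" "g \<in> G \<Longrightarrow> linear g" "g \<in> G \<Longrightarrow> u \<in> U \<Longrightarrow> g u \<in> U"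
    "subspace W \<Longrightarrow> W \<subseteq> U \<Longrightarrow> (\<And>g w. g \<in> G \<Longrightarrow> w \<in> W \<Longrightarrow> g w \<in> W) \<Longrightarrow> W = {0} \<or> W = U"
  using assms unfolding irreducible_under_def by (auto simp: image_subset_iff)

lemma irreducible_under_nonzero:
  assumes "irreducible_under G U"
  obtains v where "v \<in> U" "v \<noteq> 0"
  using irreducible_underD(1,2)[OF assms] subspace_0 by blast

text \<open>Halving an irreducible space. The injective operator \<open>t\<close> exchanges the two eigenspaces of the
  involution \<open>x\<close>. If \<open>W\<close> lies in the eigenspace for \<open>1\<close> and \<open>G\<close> moves the elements of \<open>W\<close> and \<open>t W\<close> only inside
  \<open>W \<union> t W\<close>, then \<open>W + t W\<close> is a \<open>G\<close>-invariant subspace of \<open>U\<close>, and \<open>W\<close> is recovered from it as its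
  intersection with the eigenspace. The condition \<open>gen\<close> thus says that \<open>H\<close> generates, together with \<open>t\<close>,
  enough of the operators in \<open>G\<close>.\<close>

lemma irreducible_under_eigenspace:
  fixes x t :: "'s::real_vector \<Rightarrow> 's"
  assumes irr: "irreducible_under G U"
    and lin: "linear x" "linear t"
    and xx: "\<And>s. x (x s) = s"
    and t_inj: "\<And>s. t s = 0 \<Longrightarrow> s = 0"
    and anti: "\<And>s. x (t s) = - t (x s)"
    and U: "x ` U \<subseteq> U" "t ` U \<subseteq> U"
    and H: "\<And>h. h \<in> H \<Longrightarrow> linear h \<and> h ` U \<subseteq> U \<and> (\<forall>s. h (x s) = x (h s))"
    and gen: "\<And>W g w. subspace W \<Longrightarrow> W \<subseteq> {u\<in>U. x u = u} \<Longrightarrow>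
        (\<And>h v. h \<in> H \<Longrightarrow> v \<in> W \<Longrightarrow> h v \<in> W) \<Longrightarrow> g \<in> G \<Longrightarrow> w \<in> W \<Longrightarrow>
        (g w \<in> W \<or> g w \<in> t ` W) \<and> (g (t w) \<in> W \<or> g (t w) \<in> t ` W)"
  shows "irreducible_under H {u\<in>U. x u = u}"
proof -
  let ?V = "{u\<in>U. x u = u}"
  note subU = irreducible_underD(1)[OF irr]
  note [simp] = linear_add[OF lin(1)] linear_add[OF lin(2)] linear_0[OF lin(1)]
    linear_0[OF lin(2)] linear_scale[OF lin(1)] linear_scale[OF lin(2)] xx
  have sub: "subspace ?V"
    using subU by (auto simp: subspace_def)
  obtain u where u: "u \<in> U" "u \<noteq> 0" using irreducible_under_nonzero[OF irr] .
  have nz: "?V \<noteq> {0}"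
    \<comment> \<open>A vector without component in the eigenspace for \<open>1\<close> is carried into it by \<open>t\<close>.\<close>
  proof (cases "u + x u = 0")
    case True
    then have "x u = - u" by (simp add: eq_neg_iff_add_eq_0 add.commute)
    then have "x (t u) = t u" using linear_neg[OF lin(2), of u] by (simp add: anti)
    then have "t u \<in> ?V" using u U by auto
    then show ?thesis using t_inj u by blast
  next
    case False
    have "u + x u \<in> ?V" using u U subspace_add[OF subU] by (auto simp: add.commute)
    with False show ?thesis by blast
  qed
  have dich: "W = {0} \<or> W = ?V"
    if W: "subspace W" "W \<subseteq> ?V" and inv: "\<And>h v. h \<in> H \<Longrightarrow> v \<in> W \<Longrightarrow> h v \<in> W" for W
  proof -
    let ?X = "{a + t b | a b. a \<in> W \<and> b \<in> W}"
    have W0: "0 \<in> W" using W(1) by (rule subspace_0)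
    have subX: "subspace ?X"
      unfolding subspace_def
    proof (intro conjI ballI allI)
      show "0 \<in> ?X" using W0 by force
      fix y z assume y: "y \<in> ?X" and z: "z \<in> ?X"
      obtain a b where 1: "y = a + t b" "a \<in> W" "b \<in> W" using y by blast
      obtain c d where 2: "z = c + t d" "c \<in> W" "d \<in> W" using z by blast
      have "y + z = (a + c) + t (b + d)" using 1 2 by simp
      moreover have "a + c \<in> W" "b + d \<in> W" using 1 2 subspace_add[OF W(1)] by auto
      ultimately show "y + z \<in> ?X" by blast
    next
      fix c y assume y: "y \<in> ?X"
      obtain a b where 1: "y = a + t b" "a \<in> W" "b \<in> W" using y by blast
      have "c *\<^sub>R y = c *\<^sub>R a + t (c *\<^sub>R b)" using 1 by (simp add: scaleR_right_distrib)
      moreover have "c *\<^sub>R a \<in> W" "c *\<^sub>R b \<in> W" using 1 subspace_scale[OF W(1)] by auto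
      ultimately show "c *\<^sub>R y \<in> ?X" by blast
    qed
    have in1: "y \<in> ?X" if "y \<in> W \<or> y \<in> t ` W" for y
      using that W0 by force
    have "?X \<subseteq> U"
      using W(2) U subspace_add[OF subU] by blast
    moreover have "g y \<in> ?X" if g: "g \<in> G" and y: "y \<in> ?X" for g y
    proof -
      obtain a b where 1: "y = a + t b" "a \<in> W" "b \<in> W" using y by blast
      have "g a \<in> ?X" using gen[of W g a] W inv g 1(2) by (intro in1) blast
      moreover have "g (t b) \<in> ?X" using gen[of W g b] W inv g 1(3) by (intro in1) blast
      ultimately show ?thesis
        using subspace_add[OF subX] linear_add[OF irreducible_underD(3)[OF irr g]] 1(1) by simp
    qed
    ultimately consider "?X = {0}" | "?X = U"
      using irreducible_underD(5)[OF irr subX] by blast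
    then show ?thesis
    proof cases
      case 1
      then have "W \<subseteq> {0}" using in1 by blast
      then show ?thesis using W0 by blast
    next
      case 2
      have "v \<in> W" if v: "v \<in> ?V" for v
      proof -
        have "v \<in> ?X" using v 2 by blast
        then obtain a b where 1: "v = a + t b" "a \<in> W" "b \<in> W" by blast
        have "x a = a" "x b = b" using 1 W(2) by auto
        then have "x v = a - t b" using 1 by (simp add: anti)
        moreover have "x v = a + t b" using v 1(1) by simp
        moreover have "t b + t b = (a + t b) - (a - t b)" by simp
        ultimately have "t b + t b = 0" by simp
        then have "t b = 0" by (simp add: scaleR_2[symmetric])
        then show ?thesis using 1 by simp
      qed
      then show ?thesis using W(2) by blast
    qed
  qed
  show ?thesis
    unfolding irreducible_under_def
  proof (intro conjI ballI allI impI)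
    fix h assume "h \<in> H"
    then show "linear h" "h ` ?V \<subseteq> ?V" using H by fastforce+
  next
    fix W assume "subspace W \<and> W \<subseteq> ?V \<and> (\<forall>g\<in>H. g ` W \<subseteq> W)"
    then show "W = {0} \<or> W = ?V" by (intro dich) (auto simp: image_subset_iff)
  qed (use sub nz in auto)
qed

text \<open>Four anticommuting involutions generate the \<open>2 \<times> 2\<close> quaternionic matrices; on an eigenspace of their
  product only one copy of the quaternions is left, generated by \<open>p q\<close> and \<open>p r\<close>. The eigenspaces are
  exchanged by \<open>p\<close>. Operators in \<open>R\<close> may commute or anticommute with the four, so that the reduction can be
  applied again to further generators while carrying along the quaternions already produced.\<close>

lemma irreducible_under_four_anticommuting:
  fixes p q r s :: "'s::real_vector \<Rightarrow> 's"
  assumes irr: "irreducible_under ({p, q, r, s} \<union> R) U"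
    and sq: "\<And>v. p (p v) = v" "\<And>v. q (q v) = v" "\<And>v. r (r v) = v" "\<And>v. s (s v) = v"
    and anti: "\<And>v. q (p v) = - p (q v)" "\<And>v. r (p v) = - p (r v)" "\<And>v. s (p v) = - p (s v)"
      "\<And>v. r (q v) = - q (r v)" "\<And>v. s (q v) = - q (s v)" "\<And>v. s (r v) = - r (s v)"
    and R: "\<And>g. g \<in> R \<Longrightarrow> (\<forall>h\<in>{p, q, r, s}. \<forall>v. g (h v) = h (g v)) \<or>
      (\<forall>h\<in>{p, q, r, s}. \<forall>v. g (h v) = - h (g v))"
  shows "irreducible_under ({\<lambda>v. p (q v), \<lambda>v. p (r v)} \<union> R) {u\<in>U. p (q (r (s u))) = u}"
proof -
  have lin: "linear p" "linear q" "linear r" "linear s" "\<And>g. g \<in> R \<Longrightarrow> linear g"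
    using irreducible_underD(3)[OF irr] by auto
  have memU: "\<And>u. u \<in> U \<Longrightarrow> p u \<in> U" "\<And>u. u \<in> U \<Longrightarrow> q u \<in> U" "\<And>u. u \<in> U \<Longrightarrow> r u \<in> U"
    "\<And>u. u \<in> U \<Longrightarrow> s u \<in> U" "\<And>g u. g \<in> R \<Longrightarrow> u \<in> U \<Longrightarrow> g u \<in> U"
    using irreducible_underD(4)[OF irr] by auto
  note rules = sq anti linear_neg[OF lin(1)] linear_neg[OF lin(2)] linear_neg[OF lin(3)]
    linear_neg[OF lin(4)]
  have lin2: "linear (\<lambda>v. f (g v))" if "linear f" "linear g" for f g :: "'s \<Rightarrow> 's"
    using linear_compose[OF that(2,1)] by (simp add: o_def)
  show ?thesis
  proof (rule irreducible_under_eigenspace[OF irr, where t = p])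
    show "linear (\<lambda>u. p (q (r (s u))))" by (intro lin2[OF lin(1)] lin2[OF lin(2)] lin2[OF lin(3)] lin)
    show "linear p" by fact
    show "p v = 0 \<Longrightarrow> v = 0" for v using sq(1)[of v] linear_0[OF lin(1)] by metis
    show "(\<lambda>u. p (q (r (s u)))) ` U \<subseteq> U" "p ` U \<subseteq> U" using memU(1-4) by auto
    show "p (q (r (s (p (q (r (s v))))))) = v" for v by (simp add: rules)
    show "p (q (r (s (p v)))) = - p (p (q (r (s v))))" for v by (simp add: rules)
  next
    fix h assume h: "h \<in> {\<lambda>v. p (q v), \<lambda>v. p (r v)} \<union> R"
    consider "h = (\<lambda>v. p (q v))" | "h = (\<lambda>v. p (r v))" | "h \<in> R" using h by blast
    then show "linear h \<and> h ` U \<subseteq> U \<and> (\<forall>v. h (p (q (r (s v)))) = p (q (r (s (h v)))))"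
    proof cases
      case 3
      then show ?thesis using lin(5)[OF 3] memU(5)[OF 3] R[OF 3] by (auto simp: rules)
    qed (use lin2[OF lin(1,2)] lin2[OF lin(1,3)] memU(1-4) in \<open>auto simp: rules\<close>)
  next
    fix W g w
    assume W: "subspace W" "W \<subseteq> {u \<in> U. p (q (r (s u))) = u}"
      and inv: "\<And>h v. h \<in> {\<lambda>v. p (q v), \<lambda>v. p (r v)} \<union> R \<Longrightarrow> v \<in> W \<Longrightarrow> h v \<in> W"
      and g: "g \<in> {p, q, r, s} \<union> R" and w: "w \<in> W"
    have neg: "- v \<in> W" if "v \<in> W" for v using subspace_neg[OF W(1) that] .
    have pq: "p (q v) \<in> W" and pr: "p (r v) \<in> W" if "v \<in> W" for v
      using inv[of "\<lambda>v. p (q v)" v] inv[of "\<lambda>v. p (r v)" v] that by auto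
    \<comment> \<open>The third quaternion unit \<open>p s\<close> is, on the eigenspace, the product of \<open>p q\<close> and \<open>p r\<close>.\<close>
    have "p (s (p (q (r (s w))))) = p (q (p (r w)))" by (simp add: rules)
    then have "p (s w) = p (q (p (r w)))" using W(2) w by auto
    then have ps: "p (s w) \<in> W" using pq pr w by metis
    have tI: "y \<in> p ` W" if "p y \<in> W" for y
      using that sq(1)[of y] by (metis imageI)
    consider "g = p" | "g = q" | "g = r" | "g = s" | "g \<in> R" using g by blast
    then show "(g w \<in> W \<or> g w \<in> p ` W) \<and> (g (p w) \<in> W \<or> g (p w) \<in> p ` W)"
    proof cases
      case 5
      have gw: "g w \<in> W" using inv 5 w by blast
      have "g (p w) = p (g w) \<or> g (p w) = p (- g w)"
        using R[OF 5] linear_neg[OF lin(1)] by auto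
      then show ?thesis using gw neg by blast
    qed (use w pq pr ps neg tI in \<open>auto simp: rules\<close>)
  qed
qed

text \<open>Two commuting copies of the quaternions generate the real \<open>4 \<times> 4\<close> matrices. The commuting involutions
  \<open>i k\<close> and \<open>j l\<close> have a common eigenspace on which nothing but \<open>R\<close> remains; it is reached by halving
  twice, with \<open>j\<close> and then \<open>i\<close> exchanging the eigenspaces.\<close>

lemma irreducible_under_two_quaternion_pairs:
  fixes i j k l :: "'s::real_vector \<Rightarrow> 's"
  assumes irr: "irreducible_under ({i, j, k, l} \<union> R) U"
    and sq: "\<And>v. i (i v) = - v" "\<And>v. j (j v) = - v" "\<And>v. k (k v) = - v" "\<And>v. l (l v) = - v"
    and anti: "\<And>v. j (i v) = - i (j v)" "\<And>v. l (k v) = - k (l v)"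
    and comm: "\<And>v. k (i v) = i (k v)" "\<And>v. k (j v) = j (k v)" "\<And>v. l (i v) = i (l v)"
      "\<And>v. l (j v) = j (l v)"
    and R: "\<And>g h v. g \<in> R \<Longrightarrow> h \<in> {i, j, k, l} \<Longrightarrow> g (h v) = h (g v)"
  shows "irreducible_under R {u\<in>U. i (k u) = u \<and> j (l u) = u}"
proof -
  have lin: "linear i" "linear j" "linear k" "linear l" "\<And>g. g \<in> R \<Longrightarrow> linear g"
    using irreducible_underD(3)[OF irr] by auto
  have memU: "\<And>u. u \<in> U \<Longrightarrow> i u \<in> U" "\<And>u. u \<in> U \<Longrightarrow> j u \<in> U" "\<And>u. u \<in> U \<Longrightarrow> k u \<in> U"
    "\<And>u. u \<in> U \<Longrightarrow> l u \<in> U" "\<And>g u. g \<in> R \<Longrightarrow> u \<in> U \<Longrightarrow> g u \<in> U"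
    using irreducible_underD(4)[OF irr] by auto
  note rules = sq anti comm linear_neg[OF lin(1)] linear_neg[OF lin(2)] linear_neg[OF lin(3)]
    linear_neg[OF lin(4)]
  have R': "g (i v) = i (g v)" "g (j v) = j (g v)" "g (k v) = k (g v)" "g (l v) = l (g v)"
    if "g \<in> R" for g v using R that by auto
  have lin2: "linear (\<lambda>v. f (g v))" if "linear f" "linear g" for f g :: "'s \<Rightarrow> 's"
    using linear_compose[OF that(2,1)] by (simp add: o_def)
  have inj_i: "v = 0" if "i v = 0" for v
    using sq(1)[of v] linear_0[OF lin(1)] that by simp
  have inj_j: "v = 0" if "j v = 0" for v
    using sq(2)[of v] linear_0[OF lin(2)] that by simp
  have irr1: "irreducible_under ({i, \<lambda>v. j (l v)} \<union> R) {u\<in>U. i (k u) = u}"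
  proof (rule irreducible_under_eigenspace[OF irr, where t = j])
    show "linear (\<lambda>u. i (k u))" by (rule lin2[OF lin(1,3)])
    show "linear j" by fact
    show "j v = 0 \<Longrightarrow> v = 0" for v by (rule inj_j)
    show "(\<lambda>u. i (k u)) ` U \<subseteq> U" "j ` U \<subseteq> U" using memU(1-4) by auto
    show "i (k (i (k v))) = v" for v by (simp add: rules)
    show "i (k (j v)) = - j (i (k v))" for v by (simp add: rules)
  next
    fix h assume h: "h \<in> {i, \<lambda>v. j (l v)} \<union> R"
    consider "h = i" | "h = (\<lambda>v. j (l v))" | "h \<in> R" using h by blast
    then show "linear h \<and> h ` U \<subseteq> U \<and> (\<forall>v. h (i (k v)) = i (k (h v)))"
    proof cases
      case 3
      then show ?thesis using lin(5)[OF 3] memU(5)[OF 3] by (auto simp: R'[OF 3])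
    qed (use lin2[OF lin(2,4)] lin(1-4) memU(1-4) in \<open>auto simp: rules\<close>)
  next
    fix W g w
    assume W: "subspace W" "W \<subseteq> {u \<in> U. i (k u) = u}"
      and inv: "\<And>h v. h \<in> {i, \<lambda>v. j (l v)} \<union> R \<Longrightarrow> v \<in> W \<Longrightarrow> h v \<in> W"
      and g: "g \<in> {i, j, k, l} \<union> R" and w: "w \<in> W"
    have neg: "- v \<in> W" if "v \<in> W" for v using subspace_neg[OF W(1) that] .
    have iW: "i v \<in> W" and jl: "j (l v) \<in> W" if "v \<in> W" for v
      using inv[of i v] inv[of "\<lambda>v. j (l v)" v] that by auto
    have "k (i (k w)) = - i w" by (simp add: rules)
    then have kw: "k w = - i w" using W(2) w by auto
    have tI: "y \<in> j ` W" if "j y \<in> W" for y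
    proof -
      have "y = j (- j y)" by (simp add: rules)
      then show ?thesis using that neg by blast
    qed
    consider "g = i" | "g = j" | "g = k" | "g = l" | "g \<in> R" using g by blast
    then show "(g w \<in> W \<or> g w \<in> j ` W) \<and> (g (j w) \<in> W \<or> g (j w) \<in> j ` W)"
    proof cases
      case 1 then show ?thesis using iW[OF w] neg by (auto intro!: tI simp: rules)
    next
      case 2 then show ?thesis using w neg by (auto simp: rules)
    next
      case 3 then show ?thesis using iW[OF w] neg by (auto intro!: tI simp: rules kw)
    next
      case 4 then show ?thesis using jl[OF w] tI by (auto simp: rules)
    next
      case 5
      then have "g w \<in> W" using inv w by blast
      then show ?thesis using 5 by (auto simp: R'[OF 5])
    qed
  qed
  have "irreducible_under R {u\<in>{u\<in>U. i (k u) = u}. j (l u) = u}"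
  proof (rule irreducible_under_eigenspace[OF irr1, where t = i])
    show "linear (\<lambda>u. j (l u))" by (rule lin2[OF lin(2,4)])
    show "linear i" by fact
    show "i v = 0 \<Longrightarrow> v = 0" for v by (rule inj_i)
    show "(\<lambda>u. j (l u)) ` {u\<in>U. i (k u) = u} \<subseteq> {u\<in>U. i (k u) = u}"
      "i ` {u\<in>U. i (k u) = u} \<subseteq> {u\<in>U. i (k u) = u}"
    proof -
      have "i (k (j (l v))) = j (l (i (k v)))" "i (k (i v)) = i (i (k v))" for v by (simp_all add: rules)
      then show "(\<lambda>u. j (l u)) ` {u\<in>U. i (k u) = u} \<subseteq> {u\<in>U. i (k u) = u}"
        "i ` {u\<in>U. i (k u) = u} \<subseteq> {u\<in>U. i (k u) = u}" using memU(1-4) by auto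
    qed
    show "j (l (j (l v))) = v" for v by (simp add: rules)
    show "j (l (i v)) = - i (j (l v))" for v by (simp add: rules)
  next
    fix h assume h: "h \<in> R"
    then show "linear h \<and> h ` {u\<in>U. i (k u) = u} \<subseteq> {u\<in>U. i (k u) = u} \<and>
        (\<forall>v. h (j (l v)) = j (l (h v)))"
      using lin(5)[OF h] memU(5)[OF h] by (auto simp: R'[OF h, symmetric])
  next
    fix W g w
    assume W: "subspace W" "W \<subseteq> {u \<in> {u\<in>U. i (k u) = u}. j (l u) = u}"
      and inv: "\<And>h v. h \<in> R \<Longrightarrow> v \<in> W \<Longrightarrow> h v \<in> W"
      and g: "g \<in> {i, \<lambda>v. j (l v)} \<union> R" and w: "w \<in> W"
    have neg: "- v \<in> W" if "v \<in> W" for v using subspace_neg[OF W(1) that] .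
    have jl: "j (l w) = w" using W(2) w by auto
    consider "g = i" | "g = (\<lambda>v. j (l v))" | "g \<in> R" using g by blast
    then show "(g w \<in> W \<or> g w \<in> i ` W) \<and> (g (i w) \<in> W \<or> g (i w) \<in> i ` W)"
    proof cases
      case 1 then show ?thesis using w neg by (auto simp: rules)
    next
      case 2
      have "j (l (i w)) = i (- w)" using jl by (simp add: rules)
      then show ?thesis using 2 w neg jl by auto
    next
      case 3
      then have "g w \<in> W" using inv w by blast
      then show ?thesis using 3 by (auto simp: R'[OF 3])
    qed
  qed
  then show ?thesis by simp
qed

section \<open>Eightfold periodicity\<close>

text \<open>Generators are indexed by numerals below, and rewriting \<open>1\<close> to \<open>Suc 0\<close> would hide the
  instances of the anticommutation rules.\<close>

declare One_nat_def [simp del]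

definition anticommuting_involutions :: "nat \<Rightarrow> (nat \<Rightarrow> 's::real_vector \<Rightarrow> 's) \<Rightarrow> bool" where
  "anticommuting_involutions n e \<longleftrightarrow>
     (\<forall>i<n. linear (e i) \<and> (\<forall>v. e i (e i v) = v)) \<and>
     (\<forall>i<n. \<forall>j<n. i \<noteq> j \<longrightarrow> (\<forall>v. e i (e j v) = - e j (e i v)))"

lemma anticommuting_involutionsD:
  assumes "anticommuting_involutions n e"
  shows "i < n \<Longrightarrow> linear (e i)" "i < n \<Longrightarrow> e i (e i v) = v"
    "i < n \<Longrightarrow> j < n \<Longrightarrow> i \<noteq> j \<Longrightarrow> e i (e j v) = - e j (e i v)"
    "i < n \<Longrightarrow> e i (- v) = - e i v" "i < n \<Longrightarrow> e i 0 = 0"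
proof -
  have *: "\<forall>i<n. linear (e i) \<and> (\<forall>v. e i (e i v) = v)"
    "\<forall>i<n. \<forall>j<n. i \<noteq> j \<longrightarrow> (\<forall>v. e i (e j v) = - e j (e i v))"
    using assms unfolding anticommuting_involutions_def by blast+
  show "i < n \<Longrightarrow> linear (e i)" "i < n \<Longrightarrow> e i (e i v) = v"
    "i < n \<Longrightarrow> e i (- v) = - e i v" "i < n \<Longrightarrow> e i 0 = 0"
    using *(1) by (auto simp: linear_neg linear_0)
  show "i < n \<Longrightarrow> j < n \<Longrightarrow> i \<noteq> j \<Longrightarrow> e i (e j v) = - e j (e i v)"
    using *(2) by blast
qed

text \<open>The first eight generators split into two groups of four, each leaving a copy of the quaternions, and the
  two copies cancel. All involutions used are products of an even number of generators, so every \<open>J\<close>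
  that anticommutes with the generators commutes with them and preserves the resulting eigenspace.\<close>

lemma eight_periodicity:
  assumes e: "anticommuting_involutions (n + 8) e"
    and irr: "irreducible_under (e ` {..<n + 8}) U"
  obtains V where "irreducible_under ((\<lambda>i. e (i + 8)) ` {..<n}) V"
    "\<And>J. J ` U \<subseteq> U \<Longrightarrow> linear J \<Longrightarrow> (\<And>i v. i < 8 \<Longrightarrow> J (e i v) = - e i (J v)) \<Longrightarrow> J ` V \<subseteq> V"
proof -
  let ?R = "(\<lambda>i. e (i + 8)) ` {..<n}"
  let ?i = "\<lambda>v. e 0 (e 1 v)" and ?j = "\<lambda>v. e 0 (e 2 v)"
    and ?k = "\<lambda>v. e 4 (e 5 v)" and ?l = "\<lambda>v. e 4 (e 6 v)"
  note D = anticommuting_involutionsD[OF e]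
  have sq: "e i (e i v) = v" if "i < 8" for i v using D(2)[of i v] that by simp
  have neg: "e i (- v) = - e i v" if "i < 8" for i v using D(4)[of i v] that by simp
  have anti: "e i (e j v) = - e j (e i v)" if "j < i" "i < 8" for i j v
    using D(3)[of i j v] that by simp
  have antiR: "e (i + 8) (e j v) = - e j (e (i + 8) v)" if "j < 8" "i < n" for i j v
    using D(3)[of "i + 8" j v] that by simp
  have range: "e ` {..<n + 8} = {e 0, e 1, e 2, e 3} \<union> ({e 4, e 5, e 6, e 7} \<union> ?R)"
  proof -
    have "{..<n + 8} = {0, 1, 2, 3, 4, 5, 6, 7} \<union> (\<lambda>i. i + 8) ` {..<n}"
    proof -
      have ge: "i \<in> (\<lambda>i. i + 8) ` {..<n}" if "i < n + 8" "8 \<le> i" for i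
        using that by (intro image_eqI[of _ _ "i - 8"]) auto
      have lt: "i \<in> {0, 1, 2, 3, 4, 5, 6, 7}" if "i < 8" for i :: nat
        using that by (auto simp: numeral_eq_Suc less_Suc_eq One_nat_def)
      have "i \<in> {0, 1, 2, 3, 4, 5, 6, 7} \<union> (\<lambda>i. i + 8) ` {..<n}" if "i \<in> {..<n + 8}" for i
        using ge[of i] lt[of i] that by (cases "i < 8") auto
      then show ?thesis by (intro equalityI subsetI) auto
    qed
    then show ?thesis by (simp add: image_Un image_image insert_commute)
  qed
  let ?U1 = "{u\<in>U. e 0 (e 1 (e 2 (e 3 u))) = u}"
  have "irreducible_under ({?i, ?j} \<union> ({e 4, e 5, e 6, e 7} \<union> ?R)) ?U1"
  proof (rule irreducible_under_four_anticommuting[OF irr[unfolded range]])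
    fix g assume "g \<in> {e 4, e 5, e 6, e 7} \<union> ?R"
    then consider "g \<in> {e 4, e 5, e 6, e 7}" | i where "i < n" "g = e (i + 8)" by blast
    then show "(\<forall>h\<in>{e 0, e 1, e 2, e 3}. \<forall>v. g (h v) = h (g v)) \<or>
      (\<forall>h\<in>{e 0, e 1, e 2, e 3}. \<forall>v. g (h v) = - h (g v))"
    proof cases
      case 1
      then show ?thesis by (elim insertE emptyE) (simp_all add: anti)
    next
      case 2
      then show ?thesis by (simp add: antiR)
    qed
  qed (simp_all add: sq anti)
  then have irr1: "irreducible_under ({e 4, e 5, e 6, e 7} \<union> ({?i, ?j} \<union> ?R)) ?U1"
    by (simp add: insert_commute)
  let ?U2 = "{u\<in>?U1. e 4 (e 5 (e 6 (e 7 u))) = u}"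
  have "irreducible_under ({?k, ?l} \<union> ({?i, ?j} \<union> ?R)) ?U2"
  proof (rule irreducible_under_four_anticommuting[OF irr1])
    fix g assume "g \<in> {?i, ?j} \<union> ?R"
    then consider "g = ?i" | "g = ?j" | i where "i < n" "g = e (i + 8)" by blast
    then show "(\<forall>h\<in>{e 4, e 5, e 6, e 7}. \<forall>v. g (h v) = h (g v)) \<or>
      (\<forall>h\<in>{e 4, e 5, e 6, e 7}. \<forall>v. g (h v) = - h (g v))"
    proof cases
      case 1
      show ?thesis unfolding 1 by (intro disjI1) (simp add: anti neg)
    next
      case 2
      show ?thesis unfolding 2 by (intro disjI1) (simp add: anti neg)
    next
      case 3
      then show ?thesis by (intro disjI2) (simp add: antiR)
    qed
  qed (simp_all add: sq anti)
  then have irr2: "irreducible_under ({?i, ?j, ?k, ?l} \<union> ?R) ?U2"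
    by (simp add: insert_commute)
  let ?V = "{u\<in>?U2. ?i (?k u) = u \<and> ?j (?l u) = u}"
  have irr3: "irreducible_under ?R ?V"
  proof (rule irreducible_under_two_quaternion_pairs[OF irr2])
    fix g h v assume "g \<in> ?R" and h: "h \<in> {?i, ?j, ?k, ?l}"
    then obtain i where g: "i < n" "g = e (i + 8)" by blast
    from h show "g (h v) = h (g v)"
      by (elim insertE emptyE) (simp_all add: g antiR neg)
  qed (simp_all add: sq anti neg)
  have "J ` ?V \<subseteq> ?V" if J: "J ` U \<subseteq> U" "linear J" "\<And>i v. i < 8 \<Longrightarrow> J (e i v) = - e i (J v)" for J
  proof -
    have J4: "J (e a (e b (e c (e d v)))) = e a (e b (e c (e d (J v))))"
      if "a < 8" "b < 8" "c < 8" "d < 8" for a b c d v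
      using that by (simp add: J(3) neg)
    show ?thesis using J(1) by (auto simp: J4[symmetric])
  qed
  with irr3 that show thesis by blast
qed

section \<open>Irreducible systems with no further anticommuting involution\<close>

lemma central_involution_scalar:
  assumes irr: "irreducible_under G U"
    and c: "c \<in> G" "\<And>v. c (c v) = v" "\<And>g v. g \<in> G \<Longrightarrow> g (c v) = c (g v)"
  shows "\<exists>\<delta>::real. \<delta> \<noteq> 0 \<and> (\<forall>u\<in>U. c u = \<delta> *\<^sub>R u)"
proof -
  let ?V = "{u\<in>U. c u = u}"
  have lin: "linear c" using irreducible_underD(3)[OF irr c(1)] .
  have "subspace ?V"
    using irreducible_underD(1)[OF irr] linear_add[OF lin] linear_scale[OF lin] linear_0[OF lin]
    by (auto simp: subspace_def)
  moreover have "g w \<in> ?V" if "g \<in> G" "w \<in> ?V" for g w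
    using irreducible_underD(4)[OF irr that(1)] c(3)[OF that(1), of w] that(2) by auto
  ultimately have "?V = {0} \<or> ?V = U"
    using irreducible_underD(5)[OF irr, of ?V] by blast
  then show ?thesis
  proof
    assume V: "?V = {0}"
    have "c u = (-1) *\<^sub>R u" if u: "u \<in> U" for u
    proof -
      have "u + c u \<in> U"
        using u irreducible_underD(4)[OF irr c(1)] subspace_add[OF irreducible_underD(1)[OF irr]]
        by blast
      then have "u + c u \<in> ?V"
        by (simp add: linear_add[OF lin] c(2) add.commute)
      then have "u + c u = 0" using V by blast
      then show ?thesis by (simp add: eq_neg_iff_add_eq_0 add.commute)
    qed
    then show ?thesis by (intro exI[of _ "-1"]) simp
  next
    assume "?V = U"
    then have "c u = 1 *\<^sub>R u" if "u \<in> U" for u using that by auto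
    then show ?thesis by (intro exI[of _ 1]) simp
  qed
qed

lemma no_involution_anticommuting_with_central:
  assumes irr: "irreducible_under G U"
    and c: "c \<in> G" "\<And>v. c (c v) = v" "\<And>g v. g \<in> G \<Longrightarrow> g (c v) = c (g v)"
    and J: "linear J" "\<And>v. J (J v) = v" "J ` U \<subseteq> U" "\<And>v. J (c v) = - c (J v)"
  shows False
proof -
  obtain \<delta> :: real where \<delta>: "\<delta> \<noteq> 0" "\<And>u. u \<in> U \<Longrightarrow> c u = \<delta> *\<^sub>R u"
    using central_involution_scalar[OF irr c] by blast
  obtain v where v: "v \<in> U" "v \<noteq> 0" using irreducible_under_nonzero[OF irr] .
  have "\<delta> *\<^sub>R J v = - (\<delta> *\<^sub>R J v)"
    using J(4)[of v] \<delta>(2)[OF v(1)] \<delta>(2)[of "J v"] J(3) v(1) linear_scale[OF J(1)] by auto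
  then have "\<delta> *\<^sub>R J v + \<delta> *\<^sub>R J v = 0"
    by (simp only: eq_neg_iff_add_eq_0)
  then have "J v = 0" using \<delta>(1) by (simp add: scaleR_2[symmetric])
  then have "v = 0" using J(2)[of v] linear_0[OF J(1)] by simp
  with v show False by simp
qed

text \<open>Two anticommuting involutions generate all real \<open>2 \<times> 2\<close> matrices, so the eigenspace \<open>V\<close> of \<open>e 0\<close> is a
  line. But \<open>J e\<^sub>1 e\<^sub>0\<close> commutes with \<open>e 0\<close>, hence acts on this line, and has square \<open>- 1\<close>.\<close>

lemma no_extra_involution_two:
  assumes e: "anticommuting_involutions 2 e"
    and irr: "irreducible_under (e ` {..<2}) U"
    and J: "linear J" "\<And>v. J (J v) = v" "J ` U \<subseteq> U" "\<And>i v. i < 2 \<Longrightarrow> J (e i v) = - e i (J v)"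
  shows False
proof -
  note D = anticommuting_involutionsD[OF e]
  have lin: "linear (e 0)" "linear (e 1)" using D(1) by auto
  note rules = D(2)[of 0] D(2)[of 1] D(3)[of 1 0] D(4)[of 0] D(4)[of 1] J(2) J(4)[of 0] J(4)[of 1]
    linear_neg[OF J(1)]
  have eU: "e 0 u \<in> U" "e 1 u \<in> U" if "u \<in> U" for u
    using irreducible_underD(4)[OF irr, of "e _" u] that by auto
  let ?V = "{u\<in>U. e 0 u = u}"
  have irrV: "irreducible_under {} ?V"
  proof (rule irreducible_under_eigenspace[OF irr lin])
    fix W :: "'a set" and g w
    assume W: "subspace W" "W \<subseteq> ?V" and g: "g \<in> e ` {..<2}" and w: "w \<in> W"
    have fix_w: "e 0 w = w" using W(2) w by auto
    have "e 0 (e 1 w) = e 1 (- w)"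
      using D(3)[of 0 1 w] D(4)[of 1 w] fix_w by simp
    then have e01: "e 0 (e 1 w) \<in> e 1 ` W" using subspace_neg[OF W(1) w] by blast
    have "g = e 0 \<or> g = e 1" using g by (auto simp: less_2_cases_iff One_nat_def)
    then show "(g w \<in> W \<or> g w \<in> e 1 ` W) \<and> (g (e 1 w) \<in> W \<or> g (e 1 w) \<in> e 1 ` W)"
    proof
      assume "g = e 0" then show ?thesis using w fix_w e01 by simp
    next
      assume "g = e 1" then show ?thesis using w by (auto simp: rules)
    qed
  next
    show "e 1 v = 0 \<Longrightarrow> v = 0" for v using D(2)[of 1 v] D(5)[of 1] by simp
    show "e 0 (e 1 v) = - e 1 (e 0 v)" for v using D(3)[of 0 1 v] by simp
  qed (use eU in \<open>auto simp: rules\<close>)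
  obtain v where v: "v \<in> ?V" "v \<noteq> 0" using irreducible_under_nonzero[OF irrV] .
  have "span {v} \<subseteq> ?V"
    using span_minimal[of "{v}" ?V] v(1) irreducible_underD(1)[OF irrV] by blast
  then have "span {v} = {0} \<or> span {v} = ?V"
    by (rule irreducible_underD(5)[OF irrV subspace_span]) simp
  moreover have "span {v} \<noteq> {0}" using v span_base[of v "{v}"] by auto
  ultimately have V: "?V = span {v}" by blast
  let ?K = "\<lambda>v. J (e 1 (e 0 v))"
  have "?K v \<in> ?V"
  proof -
    have "e 0 (?K v) = ?K (e 0 v)" by (simp add: rules)
    then show ?thesis using v eU J(3) by auto
  qed
  then obtain c where c: "?K v = c *\<^sub>R v" using V by (auto simp: span_singleton)
  have "(c * c) *\<^sub>R v = c *\<^sub>R ?K v" by (simp only: c scaleR_scaleR)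
  also have "\<dots> = ?K (c *\<^sub>R v)"
    by (simp add: linear_scale[OF lin(1)] linear_scale[OF lin(2)] linear_scale[OF J(1)])
  also have "\<dots> = ?K (?K v)" by (simp only: c)
  also have "\<dots> = (- 1) *\<^sub>R v" by (simp add: rules)
  finally have "(c * c) *\<^sub>R v = (- 1) *\<^sub>R v" .
  then have "c * c = - 1" using scaleR_right_imp_eq[OF v(2)] by blast
  then show False using zero_le_square[of c] by linarith
qed

text \<open>Three anticommuting involutions generate the complex \<open>2 \<times> 2\<close> matrices, so the eigenspace \<open>V\<close> of \<open>e 0\<close> is a
  complex line with imaginary unit \<open>e\<^sub>1 e\<^sub>2\<close>. The operator \<open>J e\<^sub>1\<close> preserves \<open>V\<close>, has square \<open>- 1\<close> and
  anticommutes with the imaginary unit: a quaternionic structure on a real plane, which is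
  impossible for lack of dimension.\<close>

lemma no_extra_involution_three:
  assumes e: "anticommuting_involutions 3 e"
    and irr: "irreducible_under (e ` {..<3}) U"
    and J: "linear J" "\<And>v. J (J v) = v" "J ` U \<subseteq> U" "\<And>i v. i < 3 \<Longrightarrow> J (e i v) = - e i (J v)"
  shows False
proof -
  note D = anticommuting_involutionsD[OF e]
  have lin: "linear (e 0)" "linear (e 1)" "linear (e 2)" using D(1) by auto
  note rules = D(2)[of 0] D(2)[of 1] D(2)[of 2] D(3)[of 1 0] D(3)[of 2 0] D(3)[of 2 1]
    D(4)[of 0] D(4)[of 1] D(4)[of 2] J(2) J(4)[of 0] J(4)[of 1] J(4)[of 2]
    linear_neg[OF J(1)]
  have eU: "e 0 u \<in> U" "e 1 u \<in> U" "e 2 u \<in> U" if "u \<in> U" for u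
    using irreducible_underD(4)[OF irr, of "e _" u] that by auto
  let ?i = "\<lambda>u. e 1 (e 2 u)"
  have lin_i: "linear ?i" using linear_compose[OF lin(3,2)] by (simp add: o_def)
  let ?V = "{u\<in>U. e 0 u = u}"
  have irrV: "irreducible_under {?i} ?V"
  proof (rule irreducible_under_eigenspace[OF irr lin(1,2)])
    fix W :: "'a set" and g w
    assume W: "subspace W" "W \<subseteq> ?V" and g: "g \<in> e ` {..<3}" and w: "w \<in> W"
      and inv: "\<And>h v. h \<in> {?i} \<Longrightarrow> v \<in> W \<Longrightarrow> h v \<in> W"
    have fix_w: "e 0 w = w" using W(2) w by auto
    have neg: "- v \<in> W" if "v \<in> W" for v using subspace_neg[OF W(1) that] .
    have i: "e 1 (e 2 w) \<in> W" using inv w by blast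
    have "e 2 w = e 1 (e 1 (e 2 w))" by (simp add: rules)
    then have e2: "e 2 w \<in> e 1 ` W" using i by blast
    have "e 0 (e 1 w) = e 1 (- w)"
      using D(3)[of 0 1 w] D(4)[of 1 w] fix_w by simp
    then have e01: "e 0 (e 1 w) \<in> e 1 ` W" using neg[OF w] by blast
    have "g = e 0 \<or> g = e 1 \<or> g = e 2"
      using g by (auto simp: numeral_eq_Suc less_Suc_eq One_nat_def)
    then consider "g = e 0" | "g = e 1" | "g = e 2" by blast
    then show "(g w \<in> W \<or> g w \<in> e 1 ` W) \<and> (g (e 1 w) \<in> W \<or> g (e 1 w) \<in> e 1 ` W)"
    proof cases
      case 1 then show ?thesis using w fix_w e01 by simp
    next
      case 2 then show ?thesis using w by (auto simp: rules)
    next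
      case 3 then show ?thesis using e2 neg[OF i] by (auto simp: rules)
    qed
  next
    show "e 1 v = 0 \<Longrightarrow> v = 0" for v using D(2)[of 1 v] D(5)[of 1] by simp
    show "e 0 (e 1 v) = - e 1 (e 0 v)" for v using D(3)[of 0 1 v] by simp
  qed (use eU lin_i in \<open>auto simp: rules\<close>)
  obtain v where v: "v \<in> ?V" "v \<noteq> 0" using irreducible_under_nonzero[OF irrV] .
  have subV: "subspace ?V" using irreducible_underD(1)[OF irrV] .
  have iv: "?i v \<in> ?V" using irreducible_underD(4)[OF irrV, of ?i] v by blast
  let ?W = "range (\<lambda>(a, b). a *\<^sub>R v + b *\<^sub>R ?i v)"
  have "?W = {0} \<or> ?W = ?V"
  proof (rule irreducible_underD(5)[OF irrV])
    show "subspace ?W"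
    proof -
      have "linear (\<lambda>(a, b). a *\<^sub>R v + b *\<^sub>R ?i v)"
        by (rule linearI) (auto simp: algebra_simps)
      then show ?thesis by (rule linear_subspace_image) simp
    qed
    show "?W \<subseteq> ?V"
    proof
      fix y assume "y \<in> ?W"
      then obtain a b where "y = a *\<^sub>R v + b *\<^sub>R ?i v" by auto
      then show "y \<in> ?V"
        using subspace_add[OF subV subspace_scale[OF subV v(1)] subspace_scale[OF subV iv]] by simp
    qed
    fix g w assume "g \<in> {?i}" "w \<in> ?W"
    then obtain a b where "g = ?i" "w = a *\<^sub>R v + b *\<^sub>R ?i v" by auto
    then have "g w = (- b) *\<^sub>R v + a *\<^sub>R ?i v"
      by (simp add: linear_add[OF lin_i] linear_scale[OF lin_i] rules)
    then show "g w \<in> ?W" by (metis (mono_tags, lifting) case_prod_conv rangeI)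
  qed
  moreover have "v \<in> ?W" by (rule image_eqI[of _ _ "(1, 0)"]) auto
  ultimately have V: "?V = ?W" using v(2) by blast
  let ?K = "\<lambda>v. J (e 1 v)"
  have lin_K: "linear ?K" using linear_compose[OF lin(2) J(1)] by (simp add: o_def)
  have "?K v \<in> ?V"
  proof -
    have "e 0 (?K v) = ?K (e 0 v)" by (simp add: rules)
    then show ?thesis using v eU J(3) by auto
  qed
  then obtain a b where K: "?K v = a *\<^sub>R v + b *\<^sub>R ?i v" using V by auto
  have Ki: "?K (?i v) = - ?i (?K v)" by (simp add: rules)
  have "- v = ?K (?K v)" by (simp add: rules)
  also have "\<dots> = a *\<^sub>R ?K v + b *\<^sub>R ?K (?i v)"
    by (subst K) (simp add: linear_add[OF lin_K] linear_scale[OF lin_K])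
  also have "\<dots> = a *\<^sub>R (a *\<^sub>R v + b *\<^sub>R ?i v) - b *\<^sub>R ?i (a *\<^sub>R v + b *\<^sub>R ?i v)"
    by (simp only: Ki K) simp
  also have "\<dots> = (a * a + b * b) *\<^sub>R v"
    by (simp add: linear_add[OF lin_i] linear_scale[OF lin_i] rules algebra_simps)
  finally have "(a * a + b * b) *\<^sub>R v = (- 1) *\<^sub>R v" by simp
  then have "a * a + b * b = - 1" using scaleR_right_imp_eq[OF v(2)] by blast
  then show False using zero_le_square[of a] zero_le_square[of b] by linarith
qed

text \<open>On the eigenspace of \<open>e\<^sub>0 e\<^sub>1 e\<^sub>2 e\<^sub>3\<close> the fifth involution \<open>e 4\<close> commutes with the quaternions left over from
  the first four.\<close>

lemma no_extra_involution_five: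
  assumes e: "anticommuting_involutions 5 e"
    and irr: "irreducible_under (e ` {..<5}) U"
    and J: "linear J" "\<And>v. J (J v) = v" "J ` U \<subseteq> U" "\<And>i v. i < 5 \<Longrightarrow> J (e i v) = - e i (J v)"
  shows False
proof -
  note D = anticommuting_involutionsD[OF e]
  have range: "e ` {..<5} = {e 0, e 1, e 2, e 3} \<union> {e 4}"
  proof -
    have "{..<5} = {0, 1, 2, 3, 4::nat}" by (auto simp: numeral_eq_Suc less_Suc_eq One_nat_def)
    then show ?thesis by auto
  qed
  have anti: "e i (e j v) = - e j (e i v)" if "j < i" "i < 5" for i j v
    using D(3)[of i j v] that by simp
  let ?U = "{u\<in>U. e 0 (e 1 (e 2 (e 3 u))) = u}"
  have irrV: "irreducible_under ({\<lambda>v. e 0 (e 1 v), \<lambda>v. e 0 (e 2 v)} \<union> {e 4}) ?U"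
    by (rule irreducible_under_four_anticommuting[OF irr[unfolded range]])
      (auto simp: D(2) anti)
  show False
  proof (rule no_involution_anticommuting_with_central[OF irrV, where c = "e 4" and J = J])
    show "J ` ?U \<subseteq> ?U"
    proof -
      have "J (e 0 (e 1 (e 2 (e 3 v)))) = e 0 (e 1 (e 2 (e 3 (J v))))" for v
        by (simp add: J(4) D(4))
      then show ?thesis using J(3) by (auto simp: image_subset_iff) metis
    qed
  qed (use J in \<open>auto simp: D(2,4) anti\<close>)
qed

lemma no_extra_involution:
  assumes "n mod 8 \<in> {1, 2, 3, 5}"
    and "anticommuting_involutions n e"
    and "irreducible_under (e ` {..<n}) U"
    and "linear J" "\<And>v. J (J v) = v" "J ` U \<subseteq> U" "\<And>i v. i < n \<Longrightarrow> J (e i v) = - e i (J v)"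
  shows False
  using assms
proof (induction n arbitrary: e U rule: less_induct)
  case (less n)
  note J = \<open>linear J\<close> \<open>\<And>v. J (J v) = v\<close> \<open>J ` U \<subseteq> U\<close>
  show False
  proof (cases "n < 8")
    case True
    then have "n \<in> {1, 2, 3, 5}" using less.prems(1) by simp
    then consider "n = 1" | "n = 2" | "n = 3" | "n = 5" by blast
    then show False
    proof cases
      case 1
      have "e ` {..<n} = {e 0}" using 1 by auto
      then have irr: "irreducible_under {e 0} U" using less.prems(3) by simp
      show False
        by (rule no_involution_anticommuting_with_central[OF irr _ _ _ J, where c = "e 0"])
          (use 1 less.prems(7) anticommuting_involutionsD(2)[OF less.prems(2)] in auto)
    next
      case 2 with no_extra_involution_two less.prems show False by blast
    next
      case 3 with no_extra_involution_three less.prems show False by blast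
    next
      case 4 with no_extra_involution_five less.prems show False by blast
    qed
  next
    case False
    define m where "m = n - 8"
    have n: "n = m + 8" using False by (simp add: m_def)
    obtain V where V: "irreducible_under ((\<lambda>i. e (i + 8)) ` {..<m}) V"
      "\<And>J. J ` U \<subseteq> U \<Longrightarrow> linear J \<Longrightarrow> (\<And>i v. i < 8 \<Longrightarrow> J (e i v) = - e i (J v)) \<Longrightarrow> J ` V \<subseteq> V"
      using eight_periodicity[OF less.prems(2,3)[unfolded n]] by blast
    have JV: "J ` V \<subseteq> V"
      using V(2)[of J] J less.prems(7) n by simp
    have e': "anticommuting_involutions m (\<lambda>i. e (i + 8))"
      unfolding anticommuting_involutions_def
    proof (intro conjI allI impI)
      note D = anticommuting_involutionsD[OF less.prems(2)[unfolded n]]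
      fix i v assume i: "i < m"
      show "linear (e (i + 8))" "e (i + 8) (e (i + 8) v) = v" using i by (simp_all add: D(1,2))
      fix j assume "j < m" "i \<noteq> j"
      then show "e (i + 8) (e (j + 8) v) = - e (j + 8) (e (i + 8) v)" using i by (intro D(3)) auto
    qed
    show False
      by (rule less.IH[OF _ _ e' V(1) J(1,2) JV]) (use n less.prems in auto)
  qed
qed

section \<open>The upper right block of the charge\<close>

text \<open>The factor \<open>c\<close> allows operators that anticommute with \<open>G\<close>: kernel and range are invariant all the same.\<close>

lemma schur_up_to_scalar:
  assumes irr: "irreducible_under G UNIV" and lin: "linear P"
    and PG: "\<And>g v. g \<in> G \<Longrightarrow> P (g v) = c *\<^sub>R g (P v)" and c: "c \<noteq> 0"
  shows "(\<forall>v. P v = 0) \<or> bij P"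
proof -
  have ker: "{v. P v = 0} = {0} \<or> {v. P v = 0} = UNIV"
  proof (rule irreducible_underD(5)[OF irr])
    show "subspace {v. P v = 0}" using linear_subspace_kernel[OF lin] .
    show "g w \<in> {v. P v = 0}" if "g \<in> G" "w \<in> {v. P v = 0}" for g w
      using PG[OF that(1)] that(2) linear_0[OF irreducible_underD(3)[OF irr that(1)]] by simp
  qed simp
  have range: "range P = {0} \<or> range P = UNIV"
  proof (rule irreducible_underD(5)[OF irr])
    show "subspace (range P)" using linear_subspace_image[OF lin] by simp
    show "g w \<in> range P" if g: "g \<in> G" and w: "w \<in> range P" for g w
    proof -
      obtain v where v: "w = P v" using w by blast
      have "g w = P ((1 / c) *\<^sub>R g v)" using PG[OF g] v c by (simp add: linear_scale[OF lin])
      then show ?thesis by blast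
    qed
  qed simp
  show ?thesis
  proof (cases "\<forall>v. P v = 0")
    case False
    then have "{v. P v = 0} = {0}" "range P = UNIV" using ker range by blast+
    then show ?thesis using linear_injective_0[OF lin] unfolding bij_def by blast
  qed simp
qed

text \<open>A single involution acts irreducibly only on a line, where all operators commute. With \<open>f = c\<close> a scalar
  the relations become \<open>h = a + T / c\<close> and \<open>T h = a T\<close>, which leaves \<open>T\<^sup>2 = 0\<close>.\<close>

lemma intertwining_vanishes_rank_one:
  fixes T a h :: "'s::real_vector \<Rightarrow> 's"
  assumes f: "\<And>v. f (f v) = v" and irr: "irreducible_under {f} UNIV"
    and lin: "linear T" "linear a"
    and T: "\<And>v. f (h v) - a (f v) = T v" and Th: "\<And>v. T (h v) = a (T v)"
  shows "T v = 0"
proof -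
  have comm: "g (f v) = f (g v)" if "g \<in> {f}" for g v using that by simp
  have "\<exists>c::real. c \<noteq> 0 \<and> (\<forall>v\<in>UNIV. f v = c *\<^sub>R v)"
    by (rule central_involution_scalar[OF irr singletonI]) (fact f comm)+
  then obtain c :: real where "c \<noteq> 0 \<and> (\<forall>v\<in>UNIV. f v = c *\<^sub>R v)" ..
  then have c: "c \<noteq> 0" "f v = c *\<^sub>R v" for v by simp_all
  obtain v0 :: 's where "v0 \<in> UNIV" and v0: "v0 \<noteq> 0"
    using irreducible_under_nonzero[OF irr] .
  have "span {v0} = {0} \<or> span {v0} = UNIV"
    by (rule irreducible_underD(5)[OF irr]) (auto simp: c(2) span_scale)
  then have span: "span {v0} = UNIV" using v0 span_base[of v0 "{v0}"] by auto
  have multiple: "\<exists>r. w = r *\<^sub>R v0" for w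
  proof -
    have "w \<in> span {v0}" using span by simp
    then show ?thesis by (auto simp: span_singleton)
  qed
  obtain \<tau> where \<tau>: "T v0 = \<tau> *\<^sub>R v0" using multiple[of "T v0"] ..
  obtain \<alpha> where \<alpha>: "a v0 = \<alpha> *\<^sub>R v0" using multiple[of "a v0"] ..
  note * = \<tau> \<alpha>
  have "c *\<^sub>R h v0 = T v0 + a (f v0)" using T[of v0] c(2) by (simp add: algebra_simps)
  then have "c *\<^sub>R h v0 = (\<tau> + c * \<alpha>) *\<^sub>R v0"
    by (simp add: c(2) * linear_scale[OF lin(2)] algebra_simps)
  then have "T (c *\<^sub>R h v0) = ((\<tau> + c * \<alpha>) * \<tau>) *\<^sub>R v0"
    by (simp add: linear_scale[OF lin(1)] *)
  moreover have "T (c *\<^sub>R h v0) = (c * \<alpha> * \<tau>) *\<^sub>R v0"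
    by (simp add: linear_scale[OF lin(1)] linear_scale[OF lin(2)] Th *)
  ultimately have "((\<tau> + c * \<alpha>) * \<tau>) *\<^sub>R v0 = (c * \<alpha> * \<tau>) *\<^sub>R v0" by simp
  then have "(\<tau> + c * \<alpha>) * \<tau> = c * \<alpha> * \<tau>" using v0 by (simp only: scaleR_cancel_right) simp
  then have "\<tau> = 0" by (simp add: algebra_simps)
  then have "T v0 = 0" using * by simp
  obtain r where "v = r *\<^sub>R v0" using multiple[of v] ..
  then show ?thesis using \<open>T v0 = 0\<close> by (simp add: linear_scale[OF lin(1)])
qed

text \<open>By Schur's argument each of \<open>P\<close> and \<open>M\<close> is zero or invertible, and the common square makes them vanish
  together. Otherwise \<open>J = P\<^sup>-\<^sup>1 M\<close> has square \<open>P\<^sup>-\<^sup>2 M\<^sup>2 = 1\<close>, and it inherits the anticommutation from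
  \<open>M\<close>.\<close>

lemma equal_squares_zero_or_involution:
  fixes P M :: "'s::real_vector \<Rightarrow> 's"
  assumes irr: "irreducible_under G UNIV" and lin: "linear P" "linear M"
    and P: "\<And>g v. g \<in> G \<Longrightarrow> P (g v) = g (P v)" and M: "\<And>g v. g \<in> G \<Longrightarrow> M (g v) = - g (M v)"
    and PM: "\<And>v. P (P v) = M (M v)" "\<And>v. P (M v) = M (P v)"
  obtains "\<And>v. P v = 0" "\<And>v. M v = 0"
  | J where "linear J" "\<And>v. J (J v) = v" "\<And>g v. g \<in> G \<Longrightarrow> J (g v) = - g (J v)"
proof -
  have schurP: "(\<forall>v. P v = 0) \<or> bij P"
    by (rule schur_up_to_scalar[OF irr lin(1), of 1]) (simp_all add: P)
  have schurM: "(\<forall>v. M v = 0) \<or> bij M"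
    by (rule schur_up_to_scalar[OF irr lin(2), of "-1"]) (simp_all add: M)
  obtain v0 :: 's where "v0 \<in> UNIV" and v0: "v0 \<noteq> 0"
    using irreducible_under_nonzero[OF irr] .
  show thesis
  proof (cases "\<forall>v. P v = 0")
    case True
    have "\<forall>v. M v = 0"
    proof (rule ccontr)
      assume "\<not> (\<forall>v. M v = 0)"
      then have "inj M" using schurM by (auto simp: bij_def)
      moreover have "M (M v0) = M (M 0)" using PM(1)[of v0] True linear_0[OF lin(2)] by simp
      ultimately show False using v0 by (simp add: inj_eq)
    qed
    with True that(1) show thesis by blast
  next
    case False
    then have "bij P" using schurP by blast
    then have inj: "P x = P y \<longleftrightarrow> x = y" for x y by (simp add: bij_def inj_eq)
    define J where "J v = inv_into UNIV P (M v)" for v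
    have PJ: "P (J v) = M v" for v unfolding J_def using \<open>bij P\<close> by (simp add: bij_is_surj surj_f_inv_f)
    have JP: "J (P v) = P (J v)" for v
    proof -
      have "P (J (P v)) = P (P (J v))" by (simp add: PJ PM(2))
      then show ?thesis by (simp only: inj)
    qed
    show thesis
    proof (rule that(2)[of J])
      show "linear J"
      proof (rule linearI)
        fix x y show "J (x + y) = J x + J y"
          unfolding inj[symmetric, of "J (x + y)"] by (simp add: linear_add[OF lin(1)] linear_add[OF lin(2)] PJ)
        fix c show "J (c *\<^sub>R x) = c *\<^sub>R J x"
          unfolding inj[symmetric, of "J (c *\<^sub>R x)"] by (simp add: linear_scale[OF lin(1)] linear_scale[OF lin(2)] PJ)
      qed
      show "J (J v) = v" for v
      proof -
        have "P (P (J (J v))) = P (J (P (J v)))" by (simp only: JP)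
        also have "\<dots> = P (P v)" by (simp only: PJ PM(1))
        finally show ?thesis by (simp only: inj)
      qed
      show "J (g v) = - g (J v)" if "g \<in> G" for g v
      proof -
        have "P (J (g v)) = P (- g (J v))"
          by (simp add: PJ M[OF that] linear_neg[OF lin(1)] P[OF that])
        then show ?thesis by (simp only: inj)
      qed
    qed
  qed
qed

text \<open>The hypotheses are the identities \<open>e\<^sub>i h - a e\<^sub>i = \<delta>\<^sub>i\<^sub>0 T\<close> and \<open>T h = a T\<close>. They force \<open>T' = e\<^sub>0 T e\<^sub>0\<close>
  to be the conjugate of \<open>T\<close> by every generator (\<open>eT\<close>) and \<open>T' T = T T' = 0\<close>; then
  \<open>(T + T')\<^sup>2 = T\<^sup>2 + T'\<^sup>2 = (T - T')\<^sup>2\<close>, so a nonzero \<open>T\<close> would produce a forbidden involution.\<close>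

lemma intertwining_vanishes:
  fixes T a h :: "'s::real_vector \<Rightarrow> 's"
  assumes n: "n mod 8 \<in> {1, 2, 3, 5}"
    and e: "anticommuting_involutions n e" and irr: "irreducible_under (e ` {..<n}) UNIV"
    and lin: "linear T" "linear a"
    and T: "\<And>v. e 0 (h v) - a (e 0 v) = T v"
    and T0: "\<And>i v. 0 < i \<Longrightarrow> i < n \<Longrightarrow> e i (h v) = a (e i v)"
    and Th: "\<And>v. T (h v) = a (T v)"
  shows "T v = 0"
proof (cases "n = 1")
  case True
  have "irreducible_under {e 0} UNIV" using irr True by (simp add: lessThan_Suc One_nat_def)
  then show ?thesis
    using intertwining_vanishes_rank_one[OF _ _ lin(1,2) T Th] anticommuting_involutionsD(2)[OF e] True by simp
next
  case False
  then have n1: "1 < n" "0 < n" using n by (cases n; auto)+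
  note D = anticommuting_involutionsD[OF e]
  have lin_e: "linear (e i)" if "i < n" for i using D(1)[OF that] .
  define T' where "T' v = e 0 (T (e 0 v))" for v
  have ee: "e i (e i v) = v" if "i < n" for i v using D(2)[OF that] .
  have eh: "e 0 (h v) = T v + a (e 0 v)" for v using T[of v] by (simp add: algebra_simps)
  have eT: "T (e i v) = e i (T' v)" if i: "i < n" for i v
  proof (cases "i = 0")
    case True
    then show ?thesis using n1 by (simp add: T'_def ee)
  next
    case False
    have he: "h (e i w) = e i (a w)" for w
    proof -
      have "e i (h (e i w)) = a w" using T0[of i "e i w"] False i ee by simp
      then show ?thesis using ee[OF i, of "h (e i w)"] by simp
    qed
    have ae: "a (e i w) = e i (h w)" for w using T0[of i w] False i by simp
    have anti: "e 0 (e i w) = - e i (e 0 w)" for w using D(3)[of 0 i w] False i n1 by simp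
    have "T (e i v) = e 0 (h (e i v)) - a (e 0 (e i v))" using T by simp
    also have "\<dots> = - e i (e 0 (a v)) + e i (h (e 0 v))"
      by (simp add: he anti linear_neg[OF lin(2)] ae)
    also have "\<dots> = e i (h (e 0 v) - e 0 (a v))"
      using linear_diff[OF lin_e[OF i]] by simp
    also have "h (e 0 v) - e 0 (a v) = T' v"
    proof -
      have "T' v = e 0 (e 0 (h (e 0 v)) - a (e 0 (e 0 v)))" unfolding T'_def T ..
      then show ?thesis using linear_diff[OF lin_e[OF n1(2)]] n1 by (simp add: ee)
    qed
    finally show ?thesis .
  qed
  have eT': "T' (e i v) = e i (T v)" if i: "i < n" for i v
    using eT[OF i, of "e i v"] ee[OF i] by metis
  have lin_T': "linear T'"
    unfolding T'_def using linear_compose[OF linear_compose[OF lin_e[OF n1(2)] lin(1)] lin_e[OF n1(2)]]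
    by (simp add: o_def)
  \<comment> \<open>Conjugating \<open>T h = a T\<close> by the second generator gives \<open>T' a = h T'\<close>. Conjugating it by the first one
    gives the same up to the terms \<open>T' T e\<^sub>0\<close> on the left and \<open>- e\<^sub>0 T T'\<close> on the right, which must
    therefore agree. But \<open>e\<^sub>0 T T' = T' T e\<^sub>0\<close>, so \<open>T' T e\<^sub>0\<close> equals its own negative.\<close>
  have T'T: "T' (T v) = 0" for v
  proof -
    have h1: "h v = e 1 (a (e 1 v))" for v using T0[of 1 v] ee[OF n1(1), of "h v"] n1 by simp
    have a1: "a v = e 1 (h (e 1 v))" for v using T0[of 1 "e 1 v"] ee[OF n1(1)] n1 by simp
    have T'a: "T' (a v) = h (T' v)" for v
    proof -
      have "T' (a v) = T' (e 1 (h (e 1 v)))" by (simp only: a1[symmetric])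
      also have "\<dots> = e 1 (T (h (e 1 v)))" by (simp only: eT'[OF n1(1)])
      also have "\<dots> = e 1 (a (e 1 (T' v)))" by (simp only: Th eT[OF n1(1)])
      finally show ?thesis by (simp only: h1[symmetric])
    qed
    let ?f = "e 0"
    note f = ee[OF n1(2)] eT[OF n1(2)] eT'[OF n1(2)]
    have fhf: "?f (h (?f v)) = T (?f v) + a v" for v using eh[of "?f v"] f by simp
    have faf: "?f (a (?f v)) = h v - ?f (T v)" for v
    proof -
      have "?f (?f (h v)) = ?f (T v) + ?f (a (?f v))"
        unfolding eh by (rule linear_add[OF lin_e[OF n1(2)]])
      then show ?thesis by (simp add: f algebra_simps)
    qed
    have tw: "T' (T (?f v)) + T' (a v) = h (T' v) - ?f (T (T' v))" for v
    proof -
      have "T' (T (?f v)) + T' (a v) = T' (?f (h (?f v)))"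
        by (simp only: fhf linear_add[OF lin_T'])
      also have "\<dots> = ?f (T (h (?f v)))" by (simp only: f)
      also have "\<dots> = ?f (a (?f (T' v)))" by (simp only: Th f)
      finally show ?thesis by (simp only: faf)
    qed
    have "T' (T (?f w)) = - T' (T (?f w))" for w
      using tw[of w] T'a[of w] f(3)[of "T' w"] f(2)[of w] by simp
    then have "T' (T (?f w)) + T' (T (?f w)) = 0" for w
      by (simp only: eq_neg_iff_add_eq_0)
    then have "T' (T (?f w)) = 0" for w by (simp add: scaleR_2[symmetric])
    from this[of "?f v"] show ?thesis by (simp add: f)
  qed
  have TT': "T (T' v) = 0" for v
  proof -
    have "T (T' v) = e 0 (T' (T (e 0 v)))"
      using eT[OF n1(2), of v] eT'[OF n1(2), of "T' v"] ee[OF n1(2)] by simp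
    then show ?thesis using T'T linear_0[OF lin_e[OF n1(2)]] by simp
  qed
  note ladd = linear_add[OF lin(1)] linear_add[OF lin_T'] linear_diff[OF lin(1)] linear_diff[OF lin_T']
  show ?thesis
  proof (rule equal_squares_zero_or_involution[OF irr, of "\<lambda>v. T v + T' v" "\<lambda>v. T v - T' v"])
    show "linear (\<lambda>v. T v + T' v)" "linear (\<lambda>v. T v - T' v)"
      using linear_compose_add[OF lin(1) lin_T'] linear_compose_sub[OF lin(1) lin_T'] by auto
    fix g v assume "g \<in> e ` {..<n}"
    then obtain i where i: "i < n" "g = e i" by auto
    show "T (g v) + T' (g v) = g (T v + T' v)" "T (g v) - T' (g v) = - g (T v - T' v)"
      using i linear_add[OF lin_e[OF i(1)]] linear_diff[OF lin_e[OF i(1)]] by (simp_all add: eT eT')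
  next
    fix v
    show "T (T v + T' v) + T' (T v + T' v) = T (T v - T' v) - T' (T v - T' v)"
      "T (T v - T' v) + T' (T v - T' v) = T (T v + T' v) - T' (T v + T' v)"
      by (simp_all add: ladd T'T TT')
  next
    assume "\<And>v. T v + T' v = 0" "\<And>v. T v - T' v = 0"
    from this[of v] have "T v + T v = 0" by (simp add: eq_neg_iff_add_eq_0)
    then show ?thesis by (simp add: scaleR_2[symmetric])
  next
    fix J assume "linear J" "\<And>v. J (J v) = v" "\<And>g v. g \<in> e ` {..<n} \<Longrightarrow> J (g v) = - g (J v)"
    then show ?thesis
      using no_extra_involution[OF n e irr, of J] by auto
  qed
qed

text \<open>Here \<open>R\<close> is the action of one vector of the Heisenberg algebra, with blocks \<open>a\<close>, \<open>d\<close>, \<open>h\<close> (upper left,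
  lower left, lower right), and \<open>P\<close> is the charge. The commutator with \<open>N 0\<close> expresses all blocks of \<open>P\<close> by
  those of \<open>R\<close>; its diagonal blocks are \<open>\<surd>2 e\<^sub>0 d\<close> and \<open>- \<surd>2 d e\<^sub>0\<close>. Since \<open>P\<close> commutes with \<open>N 0\<close>, they are
  conjugate under \<open>e\<^sub>0\<close>, which the opposite signs allow only for \<open>d = 0\<close>.\<close>

lemma block_charge_vanishes:
  fixes P R :: "'s::real_vector \<times> 's \<Rightarrow> 's \<times> 's"
  assumes n: "n mod 8 \<in> {1, 2, 3, 5}"
    and e: "anticommuting_involutions n e" and irr: "irreducible_under (e ` {..<n}) UNIV"
    and lin: "linear P" "linear R"
    and N: "\<And>i x y. N i (x, y) = (sqrt 2 *\<^sub>R e i y, 0)"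
    and NR0: "\<And>s. N 0 (R s) - R (N 0 s) = P s"
    and NR: "\<And>i s. 0 < i \<Longrightarrow> i < n \<Longrightarrow> N i (R s) = R (N i s)"
    and PN: "\<And>s. P (N 0 s) = N 0 (P s)" and PR: "\<And>s. P (R s) = R (P s)"
  shows "P s = 0"
proof -
  have n0: "0 < n" using n by (cases n) auto
  note lin_e = anticommuting_involutionsD(1)[OF e n0]
  note ee = anticommuting_involutionsD(2)[OF e n0]
  define a where "a x = fst (R (x, 0))" for x
  define d where "d x = snd (R (x, 0))" for x
  define h where "h y = snd (R (0, y))" for y
  define T where "T y = (1 / sqrt 2) *\<^sub>R fst (P (0, y))" for y
  have R1: "R (x, 0) = (a x, d x)" for x by (simp add: a_def d_def)
  have R2: "R (0, y) = (fst (R (0, y)), h y)" for y by (simp add: h_def)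
  have pair_split: "F (x, y) = F (x, 0) + F (0, y)" if "linear F" for F :: "'s \<times> 's \<Rightarrow> 's \<times> 's" and x y
    using linear_add[OF that, of "(x, 0)" "(0, y)"] by simp
  have zero: "R (0, 0) = (0, 0)" "P (0, 0) = (0, 0)"
    using linear_0[OF lin(1)] linear_0[OF lin(2)] by (simp_all add: zero_prod_def)
  have ad0: "a 0 = 0" "d 0 = 0" by (simp_all add: a_def d_def zero)
  have scale: "F (r *\<^sub>R x, 0) = r *\<^sub>R F (x, 0)" if "linear F" for F :: "'s \<times> 's \<Rightarrow> 's \<times> 's" and r x
    using linear_scale[OF that, of r "(x, 0)"] by simp
  have P1: "P (x, 0) = (sqrt 2 *\<^sub>R e 0 (d x), 0)" for x
    using NR0[of "(x, 0)"] by (simp add: R1 N ad0 linear_0[OF lin_e])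
  have P2: "P (0, y) = (sqrt 2 *\<^sub>R (e 0 (h y) - a (e 0 y)), - (sqrt 2 *\<^sub>R d (e 0 y)))" for y
  proof -
    have "P (0, y) = N 0 (fst (R (0, y)), h y) - sqrt 2 *\<^sub>R R (e 0 y, 0)"
      using NR0[of "(0, y)"] R2[of y] by (simp add: N scale[OF lin(2)])
    then show ?thesis by (simp add: R1 N scaleR_right_diff_distrib)
  qed
  have d: "d x = 0" for x
  proof -
    have "P (sqrt 2 *\<^sub>R x, 0) = N 0 (P (0, e 0 x))"
      using PN[of "(0, e 0 x)"] by (simp add: N ee)
    then have "e 0 (d (sqrt 2 *\<^sub>R x)) = e 0 (- (sqrt 2 *\<^sub>R d x))"
      by (simp add: P1 P2 N ee)
    moreover have "d (sqrt 2 *\<^sub>R x) = sqrt 2 *\<^sub>R d x" by (simp add: d_def scale[OF lin(2)])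
    ultimately have "sqrt 2 *\<^sub>R e 0 (d x) = sqrt 2 *\<^sub>R (- e 0 (d x))"
      by (simp add: linear_neg[OF lin_e] linear_scale[OF lin_e])
    then have "e 0 (d x) = - e 0 (d x)"
      by (simp only: scaleR_cancel_left) (simp add: linear_neg[OF lin_e] linear_scale[OF lin_e])
    then have "e 0 (d x) + e 0 (d x) = 0" by (simp only: eq_neg_iff_add_eq_0)
    then have "e 0 (d x) = 0" by (simp add: scaleR_2[symmetric])
    then show ?thesis using ee[of "d x"] linear_0[OF lin_e] by simp
  qed
  have P: "P (x, y) = (sqrt 2 *\<^sub>R T y, 0)" for x y
    unfolding pair_split[OF lin(1), of x y] by (simp add: P1 P2 d T_def linear_0[OF lin_e])
  have lin_fst: "linear (\<lambda>x. fst (F (x, 0)))" "linear (\<lambda>y. fst (F (0, y)))"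
    if F: "linear F" for F :: "'s \<times> 's \<Rightarrow> 's \<times> 's"
  proof -
    have 1: "linear (\<lambda>x::'s. (x, 0::'s))" "linear (\<lambda>y::'s. (0::'s, y))"
      by (auto intro!: linearI)
    note 2 = linear_compose[OF linear_compose[OF 1(1) F] linear_fst]
      linear_compose[OF linear_compose[OF 1(2) F] linear_fst]
    show "linear (\<lambda>x. fst (F (x, 0)))" "linear (\<lambda>y. fst (F (0, y)))"
      using 2 by (simp_all add: o_def)
  qed
  have lin_a: "linear a" and lin_T: "linear T"
    unfolding a_def T_def
    using lin_fst[OF lin(2)] linear_compose_scale_right[OF lin_fst(2)[OF lin(1)]] by auto
  have "T y = 0" for y
  proof (rule intertwining_vanishes[OF n e irr lin_T lin_a])
    show "e 0 (h v) - a (e 0 v) = T v" for v by (simp add: T_def P2)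
    show "e i (h v) = a (e i v)" if "0 < i" "i < n" for i v
    proof -
      have "sqrt 2 *\<^sub>R e i (h v) = fst (N i (R (0, v)))" using R2[of v] by (metis N fst_conv)
      also have "\<dots> = fst (R (N i (0, v)))" using NR[OF that] by simp
      also have "\<dots> = sqrt 2 *\<^sub>R a (e i v)" by (simp add: N R1 linear_scale[OF lin_a])
      finally show ?thesis by simp
    qed
    show "T (h v) = a (T v)" for v
    proof -
      have "sqrt 2 *\<^sub>R T (h v) = fst (P (R (0, v)))" using R2[of v] by (metis P fst_conv)
      also have "\<dots> = fst (R (P (0, v)))" using PR by simp
      also have "\<dots> = sqrt 2 *\<^sub>R a (T v)" by (simp add: P R1 linear_scale[OF lin_a])
      finally show ?thesis by simp
    qed
  qed
  then show ?thesis using P[of "fst s" "snd s"] by (simp add: zero_prod_def)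
qed

section \<open>Clifford modules as systems of anticommuting involutions\<close>

lemma clifford_module_coset:
  assumes "clifford_module g \<gamma>"
  defines "\<phi> p \<equiv> \<gamma> (clifford_ideal g +>\<^bsub>free_algebra\<^esub> p)"
  shows "linear (\<phi> p)" "\<phi> (p + q) s = \<phi> p s + \<phi> q s" "\<phi> (p * q) s = \<phi> p (\<phi> q s)"
    "\<phi> (free_const r) s = r *\<^sub>R s"
proof -
  interpret ideal "clifford_ideal g" free_algebra by (rule ideal_clifford_ideal)
  have \<gamma>: "\<gamma> \<in> ring_hom (clifford_algebra g) endo_ring"
    and const: "\<gamma> (clifford_scalar g r) s = r *\<^sub>R s" for r s
    using assms(1) unfolding clifford_module_def by auto
  note hom = rcos_ring_hom[folded clifford_algebra_def]
  have car: "p \<in> carrier free_algebra" for p :: "'a list \<Rightarrow>\<^sub>0 real"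
    by (simp add: free_algebra_def)
  note car' = ring_hom_closed[OF hom car]
  show "linear (\<phi> p)"
    using ring_hom_closed[OF \<gamma> car'] unfolding \<phi>_def endo_ring_def by simp
  show "\<phi> (p + q) s = \<phi> p s + \<phi> q s"
    using ring_hom_add[OF hom car car, of p q] ring_hom_add[OF \<gamma> car' car', of p q]
    unfolding \<phi>_def by (simp add: free_algebra_def endo_ring_def)
  show "\<phi> (p * q) s = \<phi> p (\<phi> q s)"
    using ring_hom_mult[OF hom car car, of p q] ring_hom_mult[OF \<gamma> car' car', of p q]
    unfolding \<phi>_def by (simp add: free_algebra_def endo_ring_def)
  show "\<phi> (free_const r) s = r *\<^sub>R s"
    using const unfolding \<phi>_def clifford_scalar_def .
qed

lemma clifford_ideal_relations: "clifford_relations g \<subseteq> clifford_ideal g"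
  unfolding clifford_ideal_def
  using ring.genideal_self[OF ring_free_algebra, of "clifford_relations g"]
  by (simp add: free_algebra_def)

lemma clifford_vec_add:
  "clifford_vec g (u + v) = clifford_ideal g +>\<^bsub>free_algebra\<^esub> (free_gen u + free_gen v)"
proof -
  have "free_gen (u + v) - (free_gen u + free_gen v) \<in> clifford_relations g"
    unfolding clifford_relations_def by blast
  then have "free_gen (u + v) + - (free_gen u + free_gen v) \<in> clifford_ideal g"
    using clifford_ideal_relations[of g] unfolding diff_conv_add_uminus by blast
  from clifford_coset_add_eq[OF this] show ?thesis
    unfolding clifford_vec_def by (simp only: minus_minus)
qed

lemma clifford_vec_scale:
  "clifford_vec g (r *\<^sub>R v) = clifford_ideal g +>\<^bsub>free_algebra\<^esub> (free_const r * free_gen v)"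
proof -
  have "free_gen (r *\<^sub>R v) - free_const r * free_gen v \<in> clifford_relations g"
    unfolding clifford_relations_def by blast
  then have "free_gen (r *\<^sub>R v) + - (free_const r * free_gen v) \<in> clifford_ideal g"
    using clifford_ideal_relations[of g] unfolding diff_conv_add_uminus by blast
  from clifford_coset_add_eq[OF this] show ?thesis
    unfolding clifford_vec_def by (simp only: minus_minus)
qed

lemma clifford_module_vec:
  assumes "clifford_module g \<gamma>"
  shows "linear (\<gamma> (clifford_vec g v))" "linear (\<lambda>v. \<gamma> (clifford_vec g v) s)"
    "\<gamma> (clifford_vec g v) (\<gamma> (clifford_vec g v) s) = (- g v v) *\<^sub>R s"
proof -
  note coset = clifford_module_coset[OF assms]
  show "linear (\<gamma> (clifford_vec g v))"
    unfolding clifford_vec_def by (rule coset)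
  show "linear (\<lambda>v. \<gamma> (clifford_vec g v) s)"
  proof (rule linearI)
    show "\<gamma> (clifford_vec g (u + v)) s = \<gamma> (clifford_vec g u) s + \<gamma> (clifford_vec g v) s" for u v
      unfolding clifford_vec_add coset(2) by (simp add: clifford_vec_def)
    show "\<gamma> (clifford_vec g (r *\<^sub>R v)) s = r *\<^sub>R \<gamma> (clifford_vec g v) s" for r v
      unfolding clifford_vec_scale coset(3,4) by (simp add: clifford_vec_def)
  qed
  have \<gamma>: "\<gamma> \<in> ring_hom (clifford_algebra g) endo_ring"
    and const: "\<gamma> (clifford_scalar g r) s = r *\<^sub>R s" for r s
    using assms(1) unfolding clifford_module_def by auto
  interpret ideal "clifford_ideal g" free_algebra by (rule ideal_clifford_ideal)
  have "clifford_vec g v \<in> carrier (clifford_algebra g)"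
    unfolding clifford_vec_def
    by (rule ring_hom_closed[OF rcos_ring_hom[folded clifford_algebra_def]]) (simp add: free_algebra_def)
  from ring_hom_mult[OF \<gamma> this this]
  have "\<gamma> (clifford_scalar g (- g v v)) = \<gamma> (clifford_vec g v) \<circ> \<gamma> (clifford_vec g v)"
    unfolding clifford_vec_square by (simp add: endo_ring_def)
  then show "\<gamma> (clifford_vec g v) (\<gamma> (clifford_vec g v) s) = (- g v v) *\<^sub>R s"
    using const[of "- g v v" s] by simp
qed

text \<open>The Clifford algebra is spanned by products of vectors: its elements are classes of finite
  combinations of words, on which one can argue by induction.\<close>

lemma clifford_invariant_subspace:
  assumes mod: "clifford_module g \<gamma>" and W: "subspace W"
    and inv: "\<And>v w. w \<in> W \<Longrightarrow> \<gamma> (clifford_vec g v) w \<in> W"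
    and x: "x \<in> carrier (clifford_algebra g)" and w: "w \<in> W"
  shows "\<gamma> x w \<in> W"
proof -
  note coset = clifford_module_coset[OF mod]
  let ?\<phi> = "\<lambda>p. \<gamma> (clifford_ideal g +>\<^bsub>free_algebra\<^esub> p)"
  have monomial: "?\<phi> (Poly_Mapping.single l r) w \<in> W" if "w \<in> W" for l r w
    using that
  proof (induction l arbitrary: r w)
    case Nil
    then show ?case
      using coset(4)[of r w] subspace_scale[OF W] by (simp add: free_const_def)
  next
    case (Cons v l)
    have "Poly_Mapping.single (v # l) r = free_gen v * Poly_Mapping.single l r"
      by (simp add: free_gen_def mult_single plus_list_def)
    then have "?\<phi> (Poly_Mapping.single (v # l) r) w = \<gamma> (clifford_vec g v) (?\<phi> (Poly_Mapping.single l r) w)"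
      by (simp add: coset(3) clifford_vec_def)
    then show ?case using Cons inv by simp
  qed
  have all: "?\<phi> p w \<in> W" for p
  proof (induction p rule: Poly_Mapping.update_induct)
    case const
    have "?\<phi> 0 w = 0"
      using coset(4)[of 0 w] by (simp add: free_const_def)
    then show ?case using subspace_0[OF W] by simp
  next
    case (update p l r)
    then have "Poly_Mapping.update l r p = p + Poly_Mapping.single l r"
      by (intro poly_mapping_eqI) (auto simp: lookup_update lookup_add lookup_single when_def in_keys_iff)
    then show ?case
      using subspace_add[OF W update(3) monomial[OF w, of l r]] by (simp add: coset(2))
  qed
  from x obtain p where "x = clifford_ideal g +>\<^bsub>free_algebra\<^esub> p"
    unfolding clifford_algebra_def FactRing_def A_RCOSETS_def' by auto
  then show ?thesis using all by simp
qed

text \<open>The minus sign of \<^const>\<open>neg_form\<close> cancels the one in \<open>v\<^sup>2 = - \<langle>v, v\<rangle>\<close>, so unit vectors act as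
  involutions. Polarization of the square gives the anticommutation of orthogonal vectors.\<close>

lemma irreducible_clifford_module_basis:
  fixes \<gamma> :: "('e::euclidean_space list \<Rightarrow>\<^sub>0 real) set \<Rightarrow> 's::real_vector \<Rightarrow> 's"
  assumes irr: "irreducible_clifford_module neg_form \<gamma>" and \<iota>: "bij_betw \<iota> {..<n} Basis"
  defines "e i \<equiv> \<gamma> (clifford_vec neg_form (\<iota> i))"
  shows "anticommuting_involutions n e" "irreducible_under (e ` {..<n}) UNIV"
proof -
  have mod: "clifford_module neg_form \<gamma>"
    and nz: "\<exists>s::'s. s \<noteq> 0"
    and dich: "\<And>W. subspace W \<Longrightarrow> (\<forall>x\<in>carrier (clifford_algebra neg_form). \<gamma> x ` W \<subseteq> W) \<Longrightarrow>
      W = {0} \<or> W = UNIV"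
    using irr unfolding irreducible_clifford_module_def by auto
  define c where "c v = \<gamma> (clifford_vec neg_form v)" for v
  have lin: "linear (c v)" and lin_v: "linear (\<lambda>v. c v s)" for v s
    unfolding c_def by (rule clifford_module_vec[OF mod])+
  have sq: "c v (c v s) = (v \<bullet> v) *\<^sub>R s" for v s
    unfolding c_def clifford_module_vec(3)[OF mod] by (simp add: neg_form_def)
  have polar: "c u (c v s) + c v (c u s) = (2 * (u \<bullet> v)) *\<^sub>R s" for u v s
  proof -
    have "c (u + v) (c (u + v) s) = c u (c u s) + c u (c v s) + (c v (c u s) + c v (c v s))"
      by (simp add: linear_add[OF lin_v] linear_add[OF lin])
    then have "c u (c v s) + c v (c u s) = ((u + v) \<bullet> (u + v)) *\<^sub>R s - (u \<bullet> u) *\<^sub>R s - (v \<bullet> v) *\<^sub>R s"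
      unfolding sq by (simp add: algebra_simps)
    then show ?thesis by (simp add: inner_add inner_commute algebra_simps flip: scaleR_2)
  qed
  have e: "e i = c (\<iota> i)" for i by (simp add: e_def c_def)
  have basis: "\<iota> i \<in> Basis" if "i < n" for i using \<iota> that by (auto simp: bij_betw_def)
  show "anticommuting_involutions n e"
    unfolding anticommuting_involutions_def
  proof (intro conjI allI impI)
    fix i v assume i: "i < n"
    show "linear (e i)" unfolding e by (rule lin)
    show "e i (e i v) = v" unfolding e sq using basis[OF i] by simp
    fix j assume "j < n" "i \<noteq> j"
    then have "\<iota> i \<bullet> \<iota> j = 0"
      using \<iota> i basis by (auto simp: inner_Basis bij_betw_def inj_on_def)
    then show "e i (e j v) = - e j (e i v)"
      using polar[of "\<iota> i" "\<iota> j" v] by (simp add: e eq_neg_iff_add_eq_0)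
  qed
  have "W = {0} \<or> W = UNIV" if W: "subspace W" and inv: "\<forall>g\<in>e ` {..<n}. g ` W \<subseteq> W" for W
  proof (rule dich[OF W], intro ballI image_subsetI)
    fix x w assume x: "x \<in> carrier (clifford_algebra (neg_form :: 'e \<Rightarrow> 'e \<Rightarrow> real))" and w: "w \<in> W"
    show "\<gamma> x w \<in> W"
    proof (rule clifford_invariant_subspace[OF mod W _ x w])
      fix v :: 'e and w assume w: "w \<in> W"
      have "c b w \<in> W" if "b \<in> Basis" for b
      proof -
        have "b \<in> \<iota> ` {..<n}" using \<iota> that by (simp add: bij_betw_def)
        then obtain i where "i < n" "b = \<iota> i" by auto
        then show ?thesis using inv w by (auto simp: e[symmetric])
      qed
      then have "(\<Sum>b\<in>Basis. (v \<bullet> b) *\<^sub>R c b w) \<in> W"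
        by (intro subspace_sum[OF W] subspace_scale[OF W])
      also have "(\<Sum>b\<in>Basis. (v \<bullet> b) *\<^sub>R c b w) = c (\<Sum>b\<in>Basis. (v \<bullet> b) *\<^sub>R b) w"
        by (simp add: linear_sum[OF lin_v] linear_scale[OF lin_v])
      finally show "\<gamma> (clifford_vec neg_form v) w \<in> W" by (simp add: euclidean_representation c_def)
    qed
  qed
  moreover have "(UNIV :: 's set) \<noteq> {0}" using nz by blast
  moreover have "linear g" if g: "g \<in> e ` {..<n}" for g
  proof -
    obtain i where "g = c (\<iota> i)" using g by (auto simp: e)
    then show ?thesis using lin by simp
  qed
  ultimately show "irreducible_under (e ` {..<n}) UNIV"
    unfolding irreducible_under_def by simp
qed

section \<open>Spin representations of the Heisenberg algebra\<close>

theorem theorem2p15: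
  fixes n :: nat
    and b :: "'e::euclidean_space \<Rightarrow> 'e \<Rightarrow> real"
    and B :: "'e \<Rightarrow> 'e"
    and \<gamma>\<^sub>0 :: "('e list \<Rightarrow>\<^sub>0 real) set \<Rightarrow> 's::real_vector \<Rightarrow> 's"
    and \<gamma> :: "('e minkowski list \<Rightarrow>\<^sub>0 real) set \<Rightarrow> 's \<times> 's \<Rightarrow> 's \<times> 's"
    and \<rho> :: "'e heis \<Rightarrow> 's \<times> 's \<Rightarrow> 's \<times> 's"
  assumes n_ge_2: "n \<ge> 2"
    and dim_E: "DIM('e) = n - 1"
    and dim_mod_8: "(n - 1) mod 8 \<in> {1, 2, 3, 5}"
    and b_bilinear: "bilinear b"
    and b_symmetric: "\<forall>x y. b x y = b y x"
    and b_nondegenerate: "\<forall>x. (\<forall>y. b x y = 0) \<longrightarrow> x = 0"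
    and B_linear: "linear B"
    and B_def: "\<forall>x y. b x y = - neg_form (B x) y"
    and S0_irreducible: "irreducible_clifford_module neg_form \<gamma>\<^sub>0"
    and S_irreducible: "irreducible_clifford_module mink_form \<gamma>"
    and S_splitting: "adapted_splitting \<gamma>\<^sub>0 \<gamma>"
    and spin: "spin_representation \<gamma> b B \<rho>"
  shows "\<rho> heis_p = (\<lambda>_. 0)"
proof -
  define m where "m = n - 1"
  obtain \<iota> :: "nat \<Rightarrow> 'e" where "bij_betw \<iota> {0..<card (Basis :: 'e set)} Basis"
    using ex_bij_betw_nat_finite[OF finite_Basis] by blast
  then have \<iota>: "bij_betw \<iota> {..<m} Basis"
    by (simp add: dim_E m_def atLeast0LessThan)
  define c where "c v = \<gamma>\<^sub>0 (clifford_vec neg_form v)" for v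
  note e = irreducible_clifford_module_basis[OF S0_irreducible \<iota>, folded c_def]
  have m0: "0 < m" using n_ge_2 by (simp add: m_def)
  have basis: "\<iota> i \<in> Basis" if "i < m" for i using \<iota> that by (auto simp: bij_betw_def)
  have rep: "linear (\<rho> x)" "linear (\<lambda>x. \<rho> x s)"
    "\<rho> (heis_bracket b x y) s = \<rho> x (\<rho> y s) - \<rho> y (\<rho> x s)" for x y s
    using spin unfolding spin_representation_def lie_representation_def by blast+
  have flat: "\<rho> (heis_dual (flat v)) (x, y) = (sqrt 2 *\<^sub>R c (B v) y, 0)" for v x y
    using spin S_splitting
    unfolding spin_representation_def adapted_splitting_def by (simp add: block_endo_def c_def)
  have b: "b u v = B u \<bullet> v" for u v using B_def by (simp add: neg_form_def)
  have "inj B"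
  proof (rule linear_injective_0[THEN iffD2, OF B_linear], intro allI impI)
    fix x assume "B x = 0"
    then have "\<forall>y. b x y = 0" by (simp add: b)
    then show "x = 0" using b_nondegenerate by blast
  qed
  then have surj: "surj B" using linear_injective_imp_surjective[OF B_linear] by blast
  \<comment> \<open>The covector corresponding to \<open>B\<^sup>-\<^sup>1 (\<iota> i)\<close> acts through Clifford multiplication by the unit vector
    \<open>\<iota> i\<close>.\<close>
  define N where "N i = \<rho> (heis_dual (flat (inv_into UNIV B (\<iota> i))))" for i
  have BB: "B (inv_into UNIV B v) = v" for v using surj by (simp add: surj_f_inv_f)
  let ?R = "\<rho> (heis_E (\<iota> 0))"
  have bracket: "N i (?R s) - ?R (N i s) = (\<iota> i \<bullet> \<iota> 0) *\<^sub>R \<rho> heis_p s" for i s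
  proof -
    have "N i (?R s) - ?R (N i s) = \<rho> (b (inv_into UNIV B (\<iota> i)) (\<iota> 0) *\<^sub>R heis_p) s"
      unfolding N_def rep(3)[symmetric] heis_bracket_flat[OF b_bilinear] ..
    then show ?thesis by (simp add: b BB linear_scale[OF rep(2)])
  qed
  have flat0: "the_inv flat (0 :: 'e \<Rightarrow>\<^sub>L real) = 0"
  proof -
    have "flat (0 :: 'e) = 0" by (rule blinfun_eqI) (simp add: flat_apply neg_form_def)
    then show ?thesis using the_inv_f_f[OF bij_is_inj[OF bij_flat], of "0 :: 'e"] by simp
  qed
  have central: "\<rho> heis_p (\<rho> x s) = \<rho> x (\<rho> heis_p s)" for x s
  proof -
    obtain \<alpha> v t where x: "x = (\<alpha>, v, t)" by (cases x)
    have "heis_bracket b heis_p x = 0"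
      unfolding x heis_bracket_def heis_p_def
      by (simp add: flat0 bilinear_lzero[OF b_bilinear] bilinear_rzero[OF b_bilinear] zero_prod_def)
    then show ?thesis using rep(3)[of heis_p x s] linear_0[OF rep(2)] by simp
  qed
  have "\<rho> heis_p s = 0" for s
  proof (rule block_charge_vanishes[OF _ e rep(1) rep(1)])
    show "m mod 8 \<in> {1, 2, 3, 5}" using dim_mod_8 by (simp add: m_def)
    show "N i (x, y) = (sqrt 2 *\<^sub>R c (\<iota> i) y, 0)" for i x y
      unfolding N_def flat BB ..
    show "N 0 (?R s) - ?R (N 0 s) = \<rho> heis_p s" for s
      unfolding bracket using basis[OF m0] by simp
    show "N i (?R s) = ?R (N i s)" if "0 < i" "i < m" for i s
    proof -
      have "\<iota> i \<noteq> \<iota> 0" using \<iota> that m0 inj_onD[of \<iota> "{..<m}" i 0] by (auto simp: bij_betw_def)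
      then have "\<iota> i \<bullet> \<iota> 0 = 0" using basis[OF that(2)] basis[OF m0] by (simp add: inner_Basis)
      then show ?thesis using bracket[of i s] by simp
    qed
    show "\<rho> heis_p (N 0 s) = N 0 (\<rho> heis_p s)" for s unfolding N_def by (rule central)
    show "\<rho> heis_p (?R s) = ?R (\<rho> heis_p s)" for s by (rule central)
  qed
  then show ?thesis by (simp add: fun_eq_iff)
qed

end
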